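(* Let $\mathsf{L}$ be $\mathsf{CK}$ extended by any subset of the axioms $\mathsf{ID}$, $\mathsf{MP}$, $\mathsf{CEM}$, and let $\mathsf{L}_g$ be the corresponding Gentzen rule set listed below. Then for every formula $A$, $\mathsf{G}\mathsf{L}_g\vdash A$ whenever $\mathsf{H}\mathsf{L}\vdash A$. Moreover, the cut rule $\frac{\Gamma,A\quad\Delta,\neg A}{\Gamma,\Delta}$ is admissible in $\mathsf{G}\mathsf{L}_g$.
   Context: Fix a set $V$ of propositional variables and $\Lambda=\{\Rightarrow\}$ (binary, infix). Formulas: $A ::= \bot\mid p\mid\neg A\mid A\land B\mid A\Rightarrow B$ ($p\in V$); $\top,\lor,\to,\leftrightarrow$ abbreviations. Sequents: finite multisets of formulas ($\Gamma,\Delta$ union; formulas = singletons). Rules: $\Gamma_1\dots\Gamma_n/\Gamma_0$, $n\ge0$. Hilbert: $\mathsf{H}\mathsf{R}\vdash A$ iff $A$ is in the least set of formulas containing substitution instances of propositional tautologies, closed under modus ponens, and containing $\bigvee\Gamma_0$ whenever it contains $\bigvee\Gamma_1,\dots,\bigvee\Gamma_n$ for $\Gamma_1\dots\Gamma_n/\Gamma_0\in\mathsf{R}$ ($\bigvee$ = disjunction of a sequent). Gentzen: $\mathsf{G}\mathsf{R}\vdash\Gamma$ iff $\Gamma$ is in the least set of sequents containing $A,\neg A,\Gamma$ and $\neg\bot,\Gamma$ for all $A,\Gamma$, closed under $\frac{\Gamma,\neg A,\neg B}{\Gamma,\neg(A\land B)}$, $\frac{\Gamma,A\quad\Gamma,B}{\Gamma,A\land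 B}$, $\frac{\Gamma,A}{\Gamma,\neg\neg A}$ and under the rules of $\mathsf{R}$. A rule set is admissible in $\mathsf{G}\mathsf{R}$ if adding it to $\mathsf{R}$ does not change the set of derivable sequents. Hilbert rule sets: $\mathsf{CK}$ = all instances of $\frac{A\leftrightarrow A'}{(A\Rightarrow B)\leftrightarrow(A'\Rightarrow B)}$ and $\frac{B_1\land\dots\land B_n\to B}{(A\Rightarrow B_1)\land\dots\land(A\Rightarrow B_n)\to(A\Rightarrow B)}$ ($n\ge0$; $n=0$ reads $B/(A\Rightarrow B)$). Axioms (all instances): $(\mathsf{ID})$ $A\Rightarrow A$; $(\mathsf{MP})$ $(A\Rightarrow B)\to(A\to B)$; $(\mathsf{CEM})$ $(A\Rightarrow B)\lor(A\Rightarrow\neg B)$. An extension is named by juxtaposition, e.g. $\mathsf{CK}\mathsf{MP}\mathsf{CEM}$. Gentzen rules (all instances, any formulas and sequents $\Gamma$); "$A_0=\dots=A_n$" denotes the premises $\neg A_0,A_i$ and $\neg A_i,A_0$ ($1\le i\le n$): $(\mathsf{CK}_g)$ $\frac{A_0=\dots=A_n\quad \neg B_1,\dots,\neg B_n,B_0}{\neg(A_1\Rightarrow B_1),\dots,\neg(A_n\Rightarrow B_n),(A_0\Rightarrow B_0),\Gamma}$ ($n\ge0$); $(\mathsf{CKID}_g)$ the same with second premise $\neg A_0,\neg B_1,\dots,\neg B_n,B_0$; $(\mathsf{MP}_g)$ $\frac{A,\neg(A\Rightarrow B),\Gamma\quad\neg B,\neg(A\Rightarrow B),\Gamma}{\neg(A\Rightarrow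 B),\Gamma}$; $(\mathsf{CKCEM}_g)$ $\frac{A_0=\dots=A_n\quad B_0,\dots,B_j,\neg B_{j+1},\dots,\neg B_n}{(A_0\Rightarrow B_0),\dots,(A_j\Rightarrow B_j),\neg(A_{j+1}\Rightarrow B_{j+1}),\dots,\neg(A_n\Rightarrow B_n),\Gamma}$ ($0\le j\le n$); $(\mathsf{CKCEMID}_g)$ the same with $\neg A_0$ added to the second premise; $(\mathsf{MPCEM}_g)$ $\frac{A,(A\Rightarrow B),\Gamma\quad B,(A\Rightarrow B),\Gamma}{(A\Rightarrow B),\Gamma}$. Correspondence $\mathsf{L}\mapsto\mathsf{L}_g$: $\mathsf{CK}\mapsto\{\mathsf{CK}_g\}$; $\mathsf{CKID}\mapsto\{\mathsf{CKID}_g\}$; $\mathsf{CKMP}\mapsto\{\mathsf{CK}_g,\mathsf{MP}_g\}$; $\mathsf{CKMPID}\mapsto\{\mathsf{CKID}_g,\mathsf{MP}_g\}$; $\mathsf{CKCEM}\mapsto\{\mathsf{CKCEM}_g\}$; $\mathsf{CKCEMID}\mapsto\{\mathsf{CKCEMID}_g\}$; $\mathsf{CKCEMMP}\mapsto\{\mathsf{CKCEM}_g,\mathsf{MP}_g,\mathsf{MPCEM}_g\}$; $\mathsf{CKCEMMPID}\mapsto\{\mathsf{CKCEMID}_g,\mathsf{MP}_g,\mathsf{MPCEM}_g\}$ (each meaning the set of all instances of the listed rules). *)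

theory Defs
  imports Main "HOL-Library.Multiset"
begin

datatype 'v fm =
    Bot  ("\<^bold>\<bottom>")
  | Var 'v
  | Neg "'v fm"  ("\<^bold>\<not> _" [75] 75)
  | And "'v fm" "'v fm"  (infixr "\<^bold>\<and>" 70)
  | Cond "'v fm" "'v fm"  (infixr "\<^bold>\<leadsto>" 60)  \<comment> \<open>the conditional of the object language\<close>

abbreviation Or :: "'v fm \<Rightarrow> 'v fm \<Rightarrow> 'v fm"  (infixr "\<^bold>\<or>" 65) where
  "A \<^bold>\<or> B \<equiv> \<^bold>\<not> (\<^bold>\<not> A \<^bold>\<and> \<^bold>\<not> B)"

abbreviation Imp :: "'v fm \<Rightarrow> 'v fm \<Rightarrow> 'v fm"  (infixr "\<^bold>\<longrightarrow>" 55) where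
  "A \<^bold>\<longrightarrow> B \<equiv> \<^bold>\<not> (A \<^bold>\<and> \<^bold>\<not> B)"

abbreviation Iff :: "'v fm \<Rightarrow> 'v fm \<Rightarrow> 'v fm"  (infix "\<^bold>\<longleftrightarrow>" 55) where
  "A \<^bold>\<longleftrightarrow> B \<equiv> (A \<^bold>\<longrightarrow> B) \<^bold>\<and> (B \<^bold>\<longrightarrow> A)"

type_synonym 'v sequent = "'v fm multiset"
type_synonym 'v seqrule = "'v sequent list \<times> 'v sequent"

text \<open>
  Tautologies are formed over their own infinite supply of letters, so that the substitution
  instances include those of every propositional tautology even when \<open>'v\<close> is a finite type.
\<close>

datatype pform = PBot | PVar nat | PNeg pform | PAnd pform pform

primrec pform_val :: "(nat \<Rightarrow> bool) \<Rightarrow> pform \<Rightarrow> bool" where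
  "pform_val v PBot \<longleftrightarrow> False"
| "pform_val v (PVar i) \<longleftrightarrow> v i"
| "pform_val v (PNeg P) \<longleftrightarrow> \<not> pform_val v P"
| "pform_val v (PAnd P Q) \<longleftrightarrow> pform_val v P \<and> pform_val v Q"

definition tautology :: "pform \<Rightarrow> bool" where
  "tautology P \<longleftrightarrow> (\<forall>v. pform_val v P)"

primrec pform_subst :: "(nat \<Rightarrow> 'v fm) \<Rightarrow> pform \<Rightarrow> 'v fm" where
  "pform_subst \<sigma> PBot = \<^bold>\<bottom>"
| "pform_subst \<sigma> (PVar i) = \<sigma> i"
| "pform_subst \<sigma> (PNeg P) = \<^bold>\<not> pform_subst \<sigma> P"
| "pform_subst \<sigma> (PAnd P Q) = pform_subst \<sigma> P \<^bold>\<and> pform_subst \<sigma> Q"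

fun disj_list :: "'v fm list \<Rightarrow> 'v fm" where
  "disj_list [] = \<^bold>\<bottom>"
| "disj_list [A] = A"
| "disj_list (A # B # As) = A \<^bold>\<or> disj_list (B # As)"

text \<open>
  A sequent is unordered, so its disjunction is taken along an arbitrary but fixed enumeration.
  Different enumerations give propositionally equivalent formulas, hence the same notion of
  Hilbert derivability; on singletons there is no choice.
\<close>

definition Disj :: "'v sequent \<Rightarrow> 'v fm" where
  "Disj \<Gamma> = disj_list (SOME As. mset As = \<Gamma>)"

lemma Disj_single [simp]: "Disj {#A#} = A"
proof -
  have "(SOME As. mset As = {#A#}) = [A]" by simp
  then show ?thesis by (simp add: Disj_def)
qed

text \<open>The empty case of \<open>conj_list\<close> is never used: the \<open>n = 0\<close> instance of the normality rule is
  spelled out separately by \<open>conj_imp\<close>.\<close>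

fun conj_list :: "'v fm list \<Rightarrow> 'v fm" where
  "conj_list [] = \<^bold>\<not> \<^bold>\<bottom>"
| "conj_list [A] = A"
| "conj_list (A # B # As) = A \<^bold>\<and> conj_list (B # As)"

definition conj_imp :: "'v fm list \<Rightarrow> 'v fm \<Rightarrow> 'v fm" where
  "conj_imp As B = (if As = [] then B else conj_list As \<^bold>\<longrightarrow> B)"

inductive hilbert :: "'v seqrule set \<Rightarrow> 'v fm \<Rightarrow> bool" for R where
  taut: "tautology P \<Longrightarrow> hilbert R (pform_subst \<sigma> P)"
| modus_ponens: "hilbert R A \<Longrightarrow> hilbert R (A \<^bold>\<longrightarrow> B) \<Longrightarrow> hilbert R B"
| rule: "(\<Gamma>s, \<Gamma>\<^sub>0) \<in> R \<Longrightarrow> \<forall>\<Gamma>\<in>set \<Gamma>s. hilbert R (Disj \<Gamma>) \<Longrightarrow> hilbert R (Disj \<Gamma>\<^sub>0)"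

inductive gentzen :: "'v seqrule set \<Rightarrow> 'v sequent \<Rightarrow> bool" for R where
  ax: "gentzen R ({#A, \<^bold>\<not> A#} + \<Gamma>)"
| neg_bot: "gentzen R ({#\<^bold>\<not> \<^bold>\<bottom>#} + \<Gamma>)"
| neg_and: "gentzen R (\<Gamma> + {#\<^bold>\<not> A, \<^bold>\<not> B#}) \<Longrightarrow> gentzen R (\<Gamma> + {#\<^bold>\<not> (A \<^bold>\<and> B)#})"
| and_intro: "gentzen R (\<Gamma> + {#A#}) \<Longrightarrow> gentzen R (\<Gamma> + {#B#}) \<Longrightarrow> gentzen R (\<Gamma> + {#A \<^bold>\<and> B#})"
| neg_neg: "gentzen R (\<Gamma> + {#A#}) \<Longrightarrow> gentzen R (\<Gamma> + {#\<^bold>\<not> (\<^bold>\<not> A)#})"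
| rule: "(\<Gamma>s, \<Gamma>\<^sub>0) \<in> R \<Longrightarrow> \<forall>\<Gamma>\<in>set \<Gamma>s. gentzen R \<Gamma> \<Longrightarrow> gentzen R \<Gamma>\<^sub>0"

definition admissible :: "'v seqrule set \<Rightarrow> 'v seqrule set \<Rightarrow> bool" where
  "admissible S R \<longleftrightarrow> (\<forall>\<Gamma>. gentzen (R \<union> S) \<Gamma> \<longleftrightarrow> gentzen R \<Gamma>)"

definition cut_rules :: "'v seqrule set" where
  "cut_rules = {([\<Gamma> + {#A#}, \<Delta> + {#\<^bold>\<not> A#}], \<Gamma> + \<Delta>) |\<Gamma> \<Delta> A. True}"

definition CK :: "'v seqrule set" where
  "CK = {([{#A \<^bold>\<longleftrightarrow> A'#}], {#(A \<^bold>\<leadsto> B) \<^bold>\<longleftrightarrow> (A' \<^bold>\<leadsto> B)#}) |A A' B. True}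
      \<union> {([{#conj_imp Bs B#}], {#conj_imp (map (\<lambda>C. A \<^bold>\<leadsto> C) Bs) (A \<^bold>\<leadsto> B)#}) |A Bs B. True}"

datatype cond_axiom = ID | MP | CEM

fun axiom_rules :: "cond_axiom \<Rightarrow> 'v seqrule set" where
  "axiom_rules ID = {([], {#A \<^bold>\<leadsto> A#}) |A. True}"
| "axiom_rules MP = {([], {#(A \<^bold>\<leadsto> B) \<^bold>\<longrightarrow> (A \<^bold>\<longrightarrow> B)#}) |A B. True}"
| "axiom_rules CEM = {([], {#(A \<^bold>\<leadsto> B) \<^bold>\<or> (A \<^bold>\<leadsto> \<^bold>\<not> B)#}) |A B. True}"

definition hilbert_rules :: "cond_axiom set \<Rightarrow> 'v seqrule set" where
  "hilbert_rules X = CK \<union> (\<Union>a\<in>X. axiom_rules a)"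

text \<open>The premises abbreviated \<open>A\<^sub>0 = \<dots> = A\<^sub>n\<close>; there are none for \<open>n = 0\<close>.\<close>

definition eq_prems :: "(nat \<Rightarrow> 'v fm) \<Rightarrow> nat \<Rightarrow> 'v sequent list" where
  "eq_prems A n = concat (map (\<lambda>i. [{#\<^bold>\<not> A 0, A i#}, {#\<^bold>\<not> A i, A 0#}]) [1..<Suc n])"

definition CKg :: "'v seqrule set" where
  "CKg = {(eq_prems A n @ [{#\<^bold>\<not> B i. i \<in># mset_set {1..n}#} + {#B 0#}],
           {#\<^bold>\<not> (A i \<^bold>\<leadsto> B i). i \<in># mset_set {1..n}#} + {#A 0 \<^bold>\<leadsto> B 0#} + \<Gamma>)
          |A B n \<Gamma>. True}"

definition CKIDg :: "'v seqrule set" where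
  "CKIDg = {(eq_prems A n @ [{#\<^bold>\<not> A 0#} + {#\<^bold>\<not> B i. i \<in># mset_set {1..n}#} + {#B 0#}],
             {#\<^bold>\<not> (A i \<^bold>\<leadsto> B i). i \<in># mset_set {1..n}#} + {#A 0 \<^bold>\<leadsto> B 0#} + \<Gamma>)
            |A B n \<Gamma>. True}"

definition MPg :: "'v seqrule set" where
  "MPg = {([{#A, \<^bold>\<not> (A \<^bold>\<leadsto> B)#} + \<Gamma>, {#\<^bold>\<not> B, \<^bold>\<not> (A \<^bold>\<leadsto> B)#} + \<Gamma>],
           {#\<^bold>\<not> (A \<^bold>\<leadsto> B)#} + \<Gamma>)
          |A B \<Gamma>. True}"

definition CKCEMg :: "'v seqrule set" where
  "CKCEMg = {(eq_prems A n @
               [{#B i. i \<in># mset_set {0..j}#} + {#\<^bold>\<not> B i. i \<in># mset_set {j+1..n}#}],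
              {#A i \<^bold>\<leadsto> B i. i \<in># mset_set {0..j}#}
                + {#\<^bold>\<not> (A i \<^bold>\<leadsto> B i). i \<in># mset_set {j+1..n}#} + \<Gamma>)
             |A B j n \<Gamma>. j \<le> n}"

definition CKCEMIDg :: "'v seqrule set" where
  "CKCEMIDg = {(eq_prems A n @
                 [{#\<^bold>\<not> A 0#} + {#B i. i \<in># mset_set {0..j}#}
                    + {#\<^bold>\<not> B i. i \<in># mset_set {j+1..n}#}],
                {#A i \<^bold>\<leadsto> B i. i \<in># mset_set {0..j}#}
                  + {#\<^bold>\<not> (A i \<^bold>\<leadsto> B i). i \<in># mset_set {j+1..n}#} + \<Gamma>)
               |A B j n \<Gamma>. j \<le> n}"

definition MPCEMg :: "'v seqrule set" where
  "MPCEMg = {([{#A, A \<^bold>\<leadsto> B#} + \<Gamma>, {#B, A \<^bold>\<leadsto> B#} + \<Gamma>], {#A \<^bold>\<leadsto> B#} + \<Gamma>) |A B \<Gamma>. True}"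

definition gentzen_rules :: "cond_axiom set \<Rightarrow> 'v seqrule set" where
  "gentzen_rules X =
     (if CEM \<in> X
      then (if ID \<in> X then CKCEMIDg else CKCEMg)
      else (if ID \<in> X then CKIDg else CKg))
     \<union> (if MP \<in> X then MPg else {})
     \<union> (if MP \<in> X \<and> CEM \<in> X then MPCEMg else {})"

end

theory Submission
  imports Defs
begin

text \<open>
  Cut is eliminated in a presentation of the calculus whose derivability relation carries a bound
  \<open>n\<close> on the number of conditional rules along a branch. Contraction holds at every rank, by
  induction on the contracted formula. Cut is proved by induction on \<open>n\<close> and then on the cut formula:
  the premises of a conditional rule live at the smaller rank, where cuts on arbitrary formulas are
  already available. This is essential with CEM, where the common antecedent \<open>A\<^sub>0\<close> of a rule
  instance may be larger than the cut formula \<open>A\<^sub>k \<leadsto> B\<^sub>k\<close>, so that no induction on the cut formula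
  alone allows one to pass from one representative of the antecedents to another.
\<close>

subsection \<open>Ranked derivations\<close>

text \<open>Only \<open>cond\<close> consumes rank, because it is the only rule whose premises
  forget the context. Propositional steps and detachments keep the context, so a formula traced
  upwards passes them at unchanged rank; hence inversion, contraction and cut all preserve the rank.
  This preservation is what the outer induction lives on: premises of conditional steps may be cut
  against each other at rank \<open>k\<close>, and the results are again premises of a step of rank
  \<open>Suc k\<close>. When a cut meets two conditional steps, they merge into one. When it meets a
  conditional step and a detachment, the antecedent supplied by the detachment makes all antecedents
  of the step derivable, and the step dissolves into a chain of detachments.\<close>

text \<open>The triple \<open>(A, B, s)\<close> stands for the conditional \<open>A \<leadsto> B\<close>, negated if \<open>s\<close> is \<open>False\<close>. With this
  encoding the left and right rules for detachment (MP and its dual under CEM) become one rule, and so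
  do the four conditional rules.\<close>

type_synonym 'v scond = "'v fm \<times> 'v fm \<times> bool"

abbreviation ante :: "'v scond \<Rightarrow> 'v fm" where "ante \<equiv> fst"
abbreviation positive :: "'v scond \<Rightarrow> bool" where "positive x \<equiv> snd (snd x)"

definition signed :: "bool \<Rightarrow> 'v fm \<Rightarrow> 'v fm" where
  "signed s A = (if s then A else \<^bold>\<not> A)"

definition lit :: "'v scond \<Rightarrow> 'v fm" where
  "lit x = signed (positive x) (ante x \<^bold>\<leadsto> fst (snd x))"

definition conseq :: "'v scond \<Rightarrow> 'v fm" where
  "conseq x = signed (positive x) (fst (snd x))"

definition id_part :: "cond_axiom set \<Rightarrow> 'v fm \<Rightarrow> 'v sequent" where
  "id_part X A = (if ID \<in> X then {#\<^bold>\<not> A#} else {#})"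

text \<open>Leaves exist at every rank and, like \<open>cond\<close>, tolerate any surrounding
  formulas, so weakening and raising the rank leave the shape of a derivation alone. The equivalence
  premises of \<open>cond\<close> range over all of \<open>M\<close>; for \<open>h\<close> itself
  they are axioms, and including them spares a distinction between the head and the rest.\<close>

inductive ranked :: "cond_axiom set \<Rightarrow> nat \<Rightarrow> 'v sequent \<Rightarrow> bool" for X where
  ax: "A \<in># S \<Longrightarrow> \<^bold>\<not> A \<in># S \<Longrightarrow> ranked X n S"
| neg_bot: "\<^bold>\<not> \<^bold>\<bottom> \<in># S \<Longrightarrow> ranked X n S"
| neg_and: "ranked X n (add_mset (\<^bold>\<not> A) (add_mset (\<^bold>\<not> B) \<Gamma>))
    \<Longrightarrow> ranked X n (add_mset (\<^bold>\<not> (A \<^bold>\<and> B)) \<Gamma>)"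
| and_intro: "ranked X n (add_mset A \<Gamma>) \<Longrightarrow> ranked X n (add_mset B \<Gamma>)
    \<Longrightarrow> ranked X n (add_mset (A \<^bold>\<and> B) \<Gamma>)"
| neg_neg: "ranked X n (add_mset A \<Gamma>) \<Longrightarrow> ranked X n (add_mset (\<^bold>\<not> (\<^bold>\<not> A)) \<Gamma>)"
| cond: "h \<in># M \<Longrightarrow> positive h \<Longrightarrow> CEM \<in> X \<or> size (filter_mset positive M) = 1
    \<Longrightarrow> \<forall>x\<in>#M. ranked X n {#\<^bold>\<not> ante h, ante x#} \<and> ranked X n {#\<^bold>\<not> ante x, ante h#}
    \<Longrightarrow> ranked X n (id_part X (ante h) + image_mset conseq M)
    \<Longrightarrow> image_mset lit M \<subseteq># S \<Longrightarrow> ranked X (Suc n) S"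
| detach: "MP \<in> X \<Longrightarrow> positive x \<longrightarrow> CEM \<in> X \<Longrightarrow> lit x \<in># S
    \<Longrightarrow> ranked X n (add_mset (ante x) S) \<Longrightarrow> ranked X n (add_mset (conseq x) S)
    \<Longrightarrow> ranked X n S"

text \<open>Everything that \<open>cond\<close> demands apart from its conclusion, so that an
  instance found in one derivation can be altered and applied to another sequent.\<close>

definition cond_premises :: "cond_axiom set \<Rightarrow> nat \<Rightarrow> 'v scond \<Rightarrow> 'v scond multiset \<Rightarrow> bool" where
  "cond_premises X n h M \<longleftrightarrow>
     h \<in># M \<and> positive h \<and> (CEM \<in> X \<or> size (filter_mset positive M) = 1) \<and>
     (\<forall>x\<in>#M. ranked X n {#\<^bold>\<not> ante h, ante x#} \<and> ranked X n {#\<^bold>\<not> ante x, ante h#}) \<and>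
     ranked X n (id_part X (ante h) + image_mset conseq M)"

lemma ranked_condI:
  "cond_premises X n h M \<Longrightarrow> image_mset lit M \<subseteq># S \<Longrightarrow> ranked X (Suc n) S"
  unfolding cond_premises_def by (blast intro: ranked.cond)

lemma ranked_weaken: "ranked X n S \<Longrightarrow> ranked X n (S + \<Delta>)"
proof (induction rule: ranked.induct)
  case (cond h M n S)
  have "image_mset lit M \<subseteq># S + \<Delta>"
    using cond.hyps by (simp add: subset_mset.add_increasing2)
  then show ?case using cond by (intro ranked.cond[of h M X n]) blast+
next
  case (detach x S n)
  then show ?case by (intro ranked.detach[of X x "S + \<Delta>"]) simp_all
qed (auto simp: ranked.neg_bot ranked.neg_and ranked.and_intro ranked.neg_neg
    intro: ranked.ax)

lemma ranked_Suc: "ranked X n S \<Longrightarrow> ranked X (Suc n) S"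
proof (induction rule: ranked.induct)
  case (cond h M n S)
  then show ?case by (intro ranked.cond[of h M X "Suc n" S]) blast+
next
  case (detach x S n)
  then show ?case by (intro ranked.detach[of X x S])
qed (auto simp: ranked.neg_bot ranked.neg_and ranked.and_intro ranked.neg_neg
    intro: ranked.ax)

lemma ranked_mono: "ranked X n S \<Longrightarrow> n \<le> k \<Longrightarrow> ranked X k S"
  \<comment> \<open>Monotonicity into the order of \<open>bool\<close>, where \<le> is
    implication.\<close>
  by (rule lift_Suc_mono_le[of "\<lambda>n. ranked X n S", simplified le_bool_def, rule_format])
    (auto intro: ranked_Suc)

text \<open>The formulas that no propositional rule decomposes. Such a formula stays in the sequent
  through every propositional step and detachment above it.\<close>

fun literal :: "'v fm \<Rightarrow> bool" where
  "literal (\<^bold>\<not> (\<^bold>\<not> A)) = False"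
| "literal (\<^bold>\<not> (A \<^bold>\<and> B)) = False"
| "literal (A \<^bold>\<and> B) = False"
| "literal _ = True"

lemma lit_eq_simps [simp]:
  "lit x \<noteq> \<^bold>\<bottom>" "lit x \<noteq> \<^bold>\<not> \<^bold>\<bottom>" "lit x \<noteq> Var p" "lit x \<noteq> \<^bold>\<not> Var p" "lit x \<noteq> A \<^bold>\<and> B"
  "lit x \<noteq> \<^bold>\<not> (A \<^bold>\<and> B)" "lit x \<noteq> \<^bold>\<not> (\<^bold>\<not> A)"
  "lit x = (A \<^bold>\<leadsto> B) \<longleftrightarrow> x = (A, B, True)" "lit x = \<^bold>\<not> (A \<^bold>\<leadsto> B) \<longleftrightarrow> x = (A, B, False)"
  "lit x = lit y \<longleftrightarrow> x = y"
  by (cases x; cases y; auto simp: lit_def signed_def)+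

text \<open>The cases of \<open>replace_formula\<close> have hypotheses \<open>L = lit x\<close>
  with the concrete formula on the left; these orientations refute them.\<close>

lemmas [simp] = lit_eq_simps(1-7)[symmetric]

text \<open>The common shape of all inductions on derivations: \<open>L\<close> is traced upwards and replaced by
  \<open>\<Delta>\<close>, so that only the steps in which \<open>L\<close> is principal have to be supplied. The set
  \<open>\<Theta>\<close> of literals is never touched on the way.\<close>

lemma replace_formula:
  assumes "ranked X n (add_mset L \<Gamma>)" and lits: "\<forall>F\<in>\<Theta>. literal F" and "\<Theta> \<subseteq> set_mset \<Gamma>"
    and ax1: "\<And>\<Gamma>. \<Theta> \<subseteq> set_mset \<Gamma> \<Longrightarrow> \<^bold>\<not> L \<in># \<Gamma> \<Longrightarrow> ranked X n (\<Gamma> + \<Delta>)"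
    and ax2: "\<And>\<Gamma> A. \<Theta> \<subseteq> set_mset \<Gamma> \<Longrightarrow> L = \<^bold>\<not> A \<Longrightarrow> A \<in># \<Gamma> \<Longrightarrow> ranked X n (\<Gamma> + \<Delta>)"
    and bot: "\<And>\<Gamma>. \<Theta> \<subseteq> set_mset \<Gamma> \<Longrightarrow> L = \<^bold>\<not> \<^bold>\<bottom> \<Longrightarrow> ranked X n (\<Gamma> + \<Delta>)"
    and nand: "\<And>\<Gamma> A B. L = \<^bold>\<not> (A \<^bold>\<and> B) \<Longrightarrow> ranked X n (add_mset (\<^bold>\<not> A) (add_mset (\<^bold>\<not> B) \<Gamma>))
      \<Longrightarrow> ranked X n (\<Gamma> + \<Delta>)"
    and conj: "\<And>\<Gamma> A B. L = A \<^bold>\<and> B \<Longrightarrow> ranked X n (add_mset A \<Gamma>) \<Longrightarrow> ranked X n (add_mset B \<Gamma>)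
      \<Longrightarrow> ranked X n (\<Gamma> + \<Delta>)"
    and nneg: "\<And>\<Gamma> A. L = \<^bold>\<not> (\<^bold>\<not> A) \<Longrightarrow> ranked X n (add_mset A \<Gamma>) \<Longrightarrow> ranked X n (\<Gamma> + \<Delta>)"
    and cnd: "\<And>\<Gamma> k h x N. \<Theta> \<subseteq> set_mset \<Gamma> \<Longrightarrow> n = Suc k \<Longrightarrow> L = lit x
      \<Longrightarrow> cond_premises X k h (add_mset x N) \<Longrightarrow> image_mset lit N \<subseteq># \<Gamma> \<Longrightarrow> ranked X n (\<Gamma> + \<Delta>)"
    and det: "\<And>\<Gamma> x. \<Theta> \<subseteq> set_mset \<Gamma> \<Longrightarrow> MP \<in> X \<Longrightarrow> positive x \<longrightarrow> CEM \<in> X \<Longrightarrow> L = lit x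
      \<Longrightarrow> ranked X n (add_mset (ante x) (\<Gamma> + \<Delta>)) \<Longrightarrow> ranked X n (add_mset (conseq x) (\<Gamma> + \<Delta>))
      \<Longrightarrow> ranked X n (\<Gamma> + \<Delta>)"
  shows "ranked X n (\<Gamma> + \<Delta>)"
proof -
  have "ranked X n (\<Gamma> + \<Delta>)"
    if "ranked X m S" "m = n" "S = add_mset L \<Gamma>" "\<Theta> \<subseteq> set_mset \<Gamma>" for m S \<Gamma>
    using that
  proof (induction arbitrary: \<Gamma> rule: ranked.induct)
    case (ax A S m)
    consider "A = L" | "\<^bold>\<not> A = L" | "A \<in># \<Gamma>" "\<^bold>\<not> A \<in># \<Gamma>"
      using ax by auto
    then show ?case
    proof cases
      case 1
      with ax have "\<^bold>\<not> L \<in># \<Gamma>" by auto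
      then show ?thesis using ax1 ax.prems by blast
    next
      case 2
      with ax have "A \<in># \<Gamma>" by auto
      then show ?thesis using ax2 2 ax.prems by blast
    next
      case 3
      then show ?thesis using ranked.ax[of A "\<Gamma> + \<Delta>"] by simp
    qed
  next
    case (neg_bot S m)
    then show ?case using bot ranked.neg_bot[of "\<Gamma> + \<Delta>"] by (cases "L = \<^bold>\<not> \<^bold>\<bottom>") auto
  next
    case (neg_and m A B \<Gamma>')
    consider "\<Gamma>' = \<Gamma>" "L = \<^bold>\<not> (A \<^bold>\<and> B)"
      | K where "\<Gamma>' = add_mset L K" "\<Gamma> = add_mset (\<^bold>\<not> (A \<^bold>\<and> B)) K"
      using neg_and.prems(2) by (auto simp: add_eq_conv_ex)
    then show ?case
    proof cases
      case 1
      then show ?thesis using nand neg_and by blast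
    next
      case 2
      \<comment> \<open>Only the decomposed formula has left the sequent, and it is not a literal,
        so it is not in \<open>\<Theta>\<close>.\<close>
      have "\<Theta> \<subseteq> set_mset (add_mset (\<^bold>\<not> A) (add_mset (\<^bold>\<not> B) K))"
        using neg_and.prems(3) lits 2 by fastforce
      then have "ranked X n (add_mset (\<^bold>\<not> A) (add_mset (\<^bold>\<not> B) K) + \<Delta>)"
        using neg_and.IH neg_and.prems(1) 2 by (simp add: add_mset_commute)
      then show ?thesis using ranked.neg_and 2 by auto
    qed
  next
    case (and_intro m A \<Gamma>' B)
    consider "\<Gamma>' = \<Gamma>" "L = A \<^bold>\<and> B"
      | K where "\<Gamma>' = add_mset L K" "\<Gamma> = add_mset (A \<^bold>\<and> B) K"
      using and_intro.prems(2) by (auto simp: add_eq_conv_ex)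
    then show ?case
    proof cases
      case 1
      then show ?thesis using conj and_intro by blast
    next
      case 2
      have "\<Theta> \<subseteq> set_mset (add_mset A K)" "\<Theta> \<subseteq> set_mset (add_mset B K)"
        using and_intro.prems(3) lits 2 by fastforce+
      then have "ranked X n (add_mset A K + \<Delta>)" "ranked X n (add_mset B K + \<Delta>)"
        using and_intro.IH and_intro.prems(1) 2 by (simp_all add: add_mset_commute)
      then show ?thesis using ranked.and_intro 2 by auto
    qed
  next
    case (neg_neg m A \<Gamma>')
    consider "\<Gamma>' = \<Gamma>" "L = \<^bold>\<not> (\<^bold>\<not> A)"
      | K where "\<Gamma>' = add_mset L K" "\<Gamma> = add_mset (\<^bold>\<not> (\<^bold>\<not> A)) K"
      using neg_neg.prems(2) by (auto simp: add_eq_conv_ex)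
    then show ?case
    proof cases
      case 1
      then show ?thesis using nneg neg_neg by blast
    next
      case 2
      have "\<Theta> \<subseteq> set_mset (add_mset A K)"
        using neg_neg.prems(3) lits 2 by fastforce
      then have "ranked X n (add_mset A K + \<Delta>)"
        using neg_neg.IH neg_neg.prems(1) 2 by (simp add: add_mset_commute)
      then show ?thesis using ranked.neg_neg 2 by auto
    qed
  next
    case (cond h M m S)
    have prems: "cond_premises X m h M"
      using cond.hyps cond.IH unfolding cond_premises_def by blast
    show ?case
    proof (cases "L \<in># image_mset lit M")
      case True
      then obtain x N where M: "M = add_mset x N" "L = lit x"
        by (metis image_iff multi_member_split set_image_mset)
      then have "image_mset lit N \<subseteq># \<Gamma>"
        using cond.hyps cond.prems by simp
      then show ?thesis using cnd[of \<Gamma> m x h N] M prems cond.prems by simp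
    next
      \<comment> \<open>Here \<open>L\<close> entered by the weakening built into
        \<open>cond\<close>, so the same instance already derives \<open>\<Gamma>\<close>.\<close>
      case False
      then have "image_mset lit M \<subseteq># \<Gamma>"
        using cond.hyps cond.prems by (metis diff_single_trivial subset_eq_diff_conv add_mset_add_single)
      then have "ranked X n \<Gamma>"
        using ranked_condI[OF prems] cond.prems(1) by simp
      then show ?thesis by (rule ranked_weaken)
    qed
  next
    case (detach x S m)
    have "ranked X n (add_mset (ante x) (\<Gamma> + \<Delta>))" "ranked X n (add_mset (conseq x) (\<Gamma> + \<Delta>))"
      using detach.IH(1)[of "add_mset (ante x) \<Gamma>"] detach.IH(2)[of "add_mset (conseq x) \<Gamma>"] detach.prems
      by (auto simp: add_mset_commute)
    then show ?case
      using det[of \<Gamma> x] ranked.detach[of X x "\<Gamma> + \<Delta>" n] detach.hyps detach.prems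
      by (cases "L = lit x") auto
  qed
  then show ?thesis using assms by blast
qed

subsection \<open>Inversion and contraction\<close>

text \<open>Axioms may be on compound formulas, so the inverted formula can be principal in one.
  That branch is repaired by a propositional step on the partner formula, which costs no rank. The
  next two inversions follow the same pattern.\<close>

lemma invert_and:
  assumes "ranked X n (add_mset (A \<^bold>\<and> B) \<Gamma>)"
  shows "ranked X n (add_mset A \<Gamma>)" "ranked X n (add_mset B \<Gamma>)"
proof -
  have ax: "ranked X n (add_mset C \<Gamma>)" if "\<^bold>\<not> (A \<^bold>\<and> B) \<in># \<Gamma>" "C = A \<or> C = B" for C \<Gamma>
  proof -
    obtain K where K: "\<Gamma> = add_mset (\<^bold>\<not> (A \<^bold>\<and> B)) K"
      using \<open>_ \<in># \<Gamma>\<close> by (metis multi_member_split)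
    have "ranked X n (add_mset (\<^bold>\<not> A) (add_mset (\<^bold>\<not> B) (add_mset C K)))"
      using that(2) by (intro ranked.ax[of C]) auto
    from ranked.neg_and[OF this] show ?thesis by (simp add: K add_mset_commute)
  qed
  have "ranked X n (\<Gamma> + {#A#})"
    by (rule replace_formula[OF assms, of "{}"]) (use ax in auto)
  then show "ranked X n (add_mset A \<Gamma>)" by simp
  have "ranked X n (\<Gamma> + {#B#})"
    by (rule replace_formula[OF assms, of "{}"]) (use ax in auto)
  then show "ranked X n (add_mset B \<Gamma>)" by simp
qed

lemma invert_neg_neg:
  assumes "ranked X n (add_mset (\<^bold>\<not> (\<^bold>\<not> A)) \<Gamma>)"
  shows "ranked X n (add_mset A \<Gamma>)"
proof -
  have ax1: "ranked X n (add_mset A \<Gamma>)" if in\<Gamma>: "\<^bold>\<not> (\<^bold>\<not> (\<^bold>\<not> A)) \<in># \<Gamma>" for \<Gamma>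
  proof -
    obtain K where K: "\<Gamma> = add_mset (\<^bold>\<not> (\<^bold>\<not> (\<^bold>\<not> A))) K"
      using multi_member_split[OF in\<Gamma>] by blast
    have "ranked X n (add_mset (\<^bold>\<not> A) (add_mset A K))"
      by (rule ranked.ax[of A]) auto
    from ranked.neg_neg[OF this] show ?thesis by (simp add: K add_mset_commute)
  qed
  have ax2: "ranked X n (add_mset A \<Gamma>)" if "\<^bold>\<not> A \<in># \<Gamma>" for \<Gamma>
    using that by (intro ranked.ax[of A]) auto
  have "ranked X n (\<Gamma> + {#A#})"
    by (rule replace_formula[OF assms, of "{}"]) (use ax1 ax2 in auto)
  then show ?thesis by simp
qed

lemma invert_neg_and:
  assumes "ranked X n (add_mset (\<^bold>\<not> (A \<^bold>\<and> B)) \<Gamma>)"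
  shows "ranked X n (add_mset (\<^bold>\<not> A) (add_mset (\<^bold>\<not> B) \<Gamma>))"
proof -
  have conj: "ranked X n (add_mset (A \<^bold>\<and> B) (\<Gamma> + {#\<^bold>\<not> A, \<^bold>\<not> B#}))" for \<Gamma>
    by (rule ranked.and_intro; rule ranked.ax[of A] ranked.ax[of B]) auto
  have ax2: "ranked X n (\<Gamma> + {#\<^bold>\<not> A, \<^bold>\<not> B#})" if "A \<^bold>\<and> B \<in># \<Gamma>" for \<Gamma>
    using conj that by (metis multi_member_split union_mset_add_mset_left)
  have ax1: "ranked X n (\<Gamma> + {#\<^bold>\<not> A, \<^bold>\<not> B#})" if "\<^bold>\<not> (\<^bold>\<not> (A \<^bold>\<and> B)) \<in># \<Gamma>" for \<Gamma>
    using ranked.neg_neg[OF conj] that by (metis multi_member_split union_mset_add_mset_left)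
  have "ranked X n (\<Gamma> + {#\<^bold>\<not> A, \<^bold>\<not> B#})"
    by (rule replace_formula[OF assms, of "{}"]) (use ax1 ax2 in \<open>auto simp: add_mset_commute\<close>)
  then show ?thesis by simp
qed

text \<open>The consequent of a negated conditional is a negation and not a subformula, so
  contraction has to recurse on size.\<close>

lemma size_conseq_less: "size (conseq x) < size (lit x)"
  by (cases x) (auto simp: conseq_def lit_def signed_def)

lemma insert_subset_mset_fresh:
  assumes "a \<notin># M" "a \<in># N" "M \<subseteq># N"
  shows "add_mset a M \<subseteq># N"
  using assms by (auto simp: subseteq_mset_def not_in_iff Suc_le_eq)

lemma ranked_contract:
  "ranked X n (add_mset A (add_mset A \<Gamma>)) \<Longrightarrow> ranked X n (add_mset A \<Gamma>)"
proof (induction "size A" arbitrary: A \<Gamma> n rule: less_induct)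
  case less
  note IH = less.hyps and der = less.prems
  show ?case
  proof (cases "literal A")
    case True
    have cnd: "ranked X n \<Gamma>" if "A \<in># \<Gamma>" "n = Suc k" "A = lit x"
      "cond_premises X k h (add_mset x N)" "image_mset lit N \<subseteq># \<Gamma>" for \<Gamma> k h x N
    proof (cases "x \<in># N")
      case True
      then obtain K where K: "N = add_mset x K" by (metis multi_member_split)
      \<comment> \<open>Both copies are principal in the same instance. Contracting their smaller
        consequents in the premise drops one of them from the instance. Without CEM they must be
        negative, since an instance then has a single positive member.\<close>
      have "ranked X k (add_mset (conseq x) (add_mset (conseq x) (id_part X (ante h) + image_mset conseq K)))"
        using that(4) by (simp add: cond_premises_def K)
      from IH[OF _ this] size_conseq_less[of x]
      have "cond_premises X k h N"
        using that(3,4) by (auto simp: cond_premises_def K split: if_splits)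
      then show ?thesis using ranked_condI that by blast
    next
      case False
      \<comment> \<open>Only the traced copy is principal. The copy kept in \<open>\<Gamma>\<close>
        takes its place, and injectivity of \<open>lit\<close> keeps it apart from the literals of
        \<open>N\<close>.\<close>
      have "image_mset lit (add_mset x N) \<subseteq># \<Gamma>"
        using insert_subset_mset_fresh[of "lit x" "image_mset lit N" \<Gamma>] that False by (simp add: image_iff)
      then show ?thesis using ranked_condI that by blast
    qed
    have "ranked X n (add_mset A \<Gamma> + {#})"
    \<comment> \<open>One copy is traced and deleted, while \<open>{A}\<close> in the role of
      \<open>\<Theta>\<close> guarantees that the other is still present wherever the first is
      principal.\<close>
    proof (rule replace_formula[OF der, of "{A}"])
      show "ranked X n (\<Gamma> + {#})" if "{A} \<subseteq> set_mset \<Gamma>" "\<^bold>\<not> A \<in># \<Gamma>" for \<Gamma>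
        using that by (intro ranked.ax[of A]) auto
      show "ranked X n (\<Gamma> + {#})" if "{A} \<subseteq> set_mset \<Gamma>" "A = \<^bold>\<not> B" "B \<in># \<Gamma>" for \<Gamma> B
        using that by (intro ranked.ax[of B]) auto
      show "ranked X n (\<Gamma> + {#})" if "{A} \<subseteq> set_mset \<Gamma>" "A = \<^bold>\<not> \<^bold>\<bottom>" for \<Gamma>
        using that by (intro ranked.neg_bot) auto
      show "ranked X n (\<Gamma> + {#})"
        if "{A} \<subseteq> set_mset \<Gamma>" "MP \<in> X" "positive x \<longrightarrow> CEM \<in> X" "A = lit x"
          "ranked X n (add_mset (ante x) (\<Gamma> + {#}))" "ranked X n (add_mset (conseq x) (\<Gamma> + {#}))" for \<Gamma> x
        by (rule ranked.detach[of X x]) (use that in auto)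
    qed (use True cnd in auto)
    then show ?thesis by simp
  next
    case False
    then consider B where "A = \<^bold>\<not> (\<^bold>\<not> B)" | B C where "A = \<^bold>\<not> (B \<^bold>\<and> C)" | B C where "A = B \<^bold>\<and> C"
      by (cases A rule: literal.cases) auto
    then show ?thesis
    proof cases
      case 1
      have "ranked X n (add_mset B (add_mset B \<Gamma>))"
        using invert_neg_neg[of X n B "add_mset B \<Gamma>"] invert_neg_neg[of X n B "add_mset A \<Gamma>"] der
        by (simp add: 1 add_mset_commute)
      then show ?thesis using IH[of B] by (simp add: 1 ranked.neg_neg)
    next
      case 2
      have "ranked X n (add_mset (\<^bold>\<not> B) (add_mset (\<^bold>\<not> C) (add_mset (\<^bold>\<not> B) (add_mset (\<^bold>\<not> C) \<Gamma>))))"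
        using invert_neg_and[of X n B C "add_mset (\<^bold>\<not> B) (add_mset (\<^bold>\<not> C) \<Gamma>)"]
          invert_neg_and[of X n B C "add_mset A \<Gamma>"] der
        by (simp add: 2 add_mset_commute)
      then have "ranked X n (add_mset (\<^bold>\<not> B) (add_mset (\<^bold>\<not> B) (add_mset (\<^bold>\<not> C) (add_mset (\<^bold>\<not> C) \<Gamma>))))"
        by (simp add: add_mset_commute)
      then have "ranked X n (add_mset (\<^bold>\<not> C) (add_mset (\<^bold>\<not> C) (add_mset (\<^bold>\<not> B) \<Gamma>)))"
        using IH[of "\<^bold>\<not> B"] by (simp add: 2 add_mset_commute)
      then have "ranked X n (add_mset (\<^bold>\<not> B) (add_mset (\<^bold>\<not> C) \<Gamma>))"
        using IH[of "\<^bold>\<not> C" n "add_mset (\<^bold>\<not> B) \<Gamma>"] by (simp add: 2 add_mset_commute)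
      then show ?thesis by (simp add: 2 ranked.neg_and)
    next
      case 3
      have "ranked X n (add_mset B (add_mset B \<Gamma>))" "ranked X n (add_mset C (add_mset C \<Gamma>))"
        using invert_and[of X n B C "add_mset B \<Gamma>"] invert_and[of X n B C "add_mset C \<Gamma>"]
          invert_and[of X n B C "add_mset A \<Gamma>"] der
        by (simp_all add: 3 add_mset_commute)
      then show ?thesis using IH[of B] IH[of C] by (simp add: 3 ranked.and_intro)
    qed
  qed
qed

text \<open>From here on only the set of formulas of a sequent matters: weaken to
  \<open>T + S\<close>, then contract every member of \<open>S\<close> into
  \<open>T\<close>.\<close>

lemma ranked_structural:
  assumes "ranked X n S" and "set_mset S \<subseteq> set_mset T"
  shows "ranked X n T"
proof -
  have "ranked X n (T + S) \<Longrightarrow> set_mset S \<subseteq> set_mset T \<Longrightarrow> ranked X n T" for S T :: "'a sequent"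
  proof (induction S)
    case (add A S)
    then obtain K where K: "T + S = add_mset A K"
      by (metis insert_DiffM insert_subset mset_add set_mset_add_mset_insert union_iff)
    then show ?case using add ranked_contract[of X n A K] by auto
  qed auto
  from this[of T S] show ?thesis
    using assms ranked_weaken[of X n S T] by (simp add: add.commute[of S T])
qed

subsection \<open>Cut\<close>

text \<open>The conclusion has the rank of the premises. A cut inside the premises of a conditional
  step thus leaves the rank of that step unchanged.\<close>

definition cut_at :: "cond_axiom set \<Rightarrow> nat \<Rightarrow> 'v fm \<Rightarrow> bool" where
  "cut_at X n A \<longleftrightarrow> (\<forall>\<Gamma> \<Delta>. ranked X n (add_mset A \<Gamma>) \<longrightarrow> ranked X n (add_mset (\<^bold>\<not> A) \<Delta>)
     \<longrightarrow> ranked X n (\<Gamma> + \<Delta>))"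

text \<open>Cut with shared context: \<open>s\<close> tells which side carries the unnegated
  formula, and the doubled context \<open>U + U\<close> is contracted away.\<close>

lemma cut_atD:
  assumes "cut_at X n A" "ranked X n S" "ranked X n T"
    and "set_mset S \<subseteq> insert (signed s A) (set_mset U)"
    and "set_mset T \<subseteq> insert (signed (\<not> s) A) (set_mset U)"
  shows "ranked X n U"
proof -
  have "ranked X n (add_mset (signed s A) U)" "ranked X n (add_mset (signed (\<not> s) A) U)"
    by (rule ranked_structural[OF assms(2)] ranked_structural[OF assms(3)]; use assms in simp)+
  then have "ranked X n (U + U)"
    using assms(1) unfolding cut_at_def signed_def by (cases s) auto
  then show ?thesis by (rule ranked_structural) auto
qed

lemmas cut_at_pos = cut_atD[where s = True, unfolded signed_def, simplified]

text \<open>Without CEM the displayed conditional is already the one positive member.\<close>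

lemma cond_premises_other_positive:
  assumes "cond_premises X k h (add_mset (C, D, True) N)" "y \<in># N" "positive y"
  shows "CEM \<in> X"
proof (rule ccontr)
  assume "CEM \<notin> X"
  with assms(1) have "filter_mset positive N = {#}"
    by (simp add: cond_premises_def del: filter_mset_eq_mempty_iff)
  with assms(2,3) show False by (metis filter_mset_eq_mempty_iff)
qed

text \<open>The mixed case of cut, stated for both signs of \<open>x\<close>: one side ends in a
  conditional step with \<open>x\<close> principal, the other in a detachment that provides the
  antecedent of \<open>x\<close> and the opposite of its consequent. All antecedents of the step are
  equivalent to \<open>ante x\<close> and so become derivable, and each remaining literal can be
  detached.\<close>

lemma detach_cond_premises:
  fixes x :: "'v scond"
  assumes "MP \<in> X" and prems: "cond_premises X k h (add_mset x N)"
    and pos: "\<forall>y\<in>#N. positive y \<longrightarrow> CEM \<in> X"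
    and low: "\<And>A :: 'v fm. cut_at X k A"
    and cuts: "cut_at X (Suc k) (ante x)" "cut_at X (Suc k) (fst (snd x))"
    and ante: "ranked X (Suc k) (add_mset (ante x) \<Gamma>)"
    and conseq: "ranked X (Suc k) (add_mset (signed (\<not> positive x) (fst (snd x))) \<Gamma>)"
    and sub: "image_mset lit N \<subseteq># \<Gamma>"
  shows "ranked X (Suc k) \<Gamma>"
proof -
  have eq: "ranked X k {#\<^bold>\<not> ante h, ante y#}" if "y \<in># N" for y
    using prems that by (simp add: cond_premises_def)
  have xh: "ranked X k {#\<^bold>\<not> ante x, ante h#}"
    using prems by (simp add: cond_premises_def)
  have antes: "ranked X (Suc k) (add_mset (ante y) (\<Delta> + \<Gamma>))" if "y \<in># N" for y \<Delta>
  proof -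
    \<comment> \<open>Antecedents are compared through \<open>ante h\<close>, an arbitrary formula;
      such a cut is available at rank \<open>k\<close> only.\<close>
    have "ranked X k {#\<^bold>\<not> ante x, ante y#}"
      by (rule cut_at_pos[OF low xh eq[OF that]]) auto
    then show ?thesis
      by (rule cut_at_pos[OF cuts(1) ante ranked_Suc]) auto
  qed
  have "ranked X k (id_part X (ante h) + image_mset conseq (add_mset x N))"
    using prems by (simp add: cond_premises_def)
  \<comment> \<open>With ID the cut on \<open>ante h\<close> turns \<open>Neg (ante h)\<close> into
    \<open>Neg (ante x)\<close>; without ID nothing has to be replaced.\<close>
  then have "ranked X k (add_mset (\<^bold>\<not> ante x) (image_mset conseq (add_mset x N)))"
    by (rule cut_at_pos[OF low xh]) (auto simp: id_part_def)
  then have "ranked X (Suc k) (add_mset (conseq x) (image_mset conseq N + \<Gamma>))"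
    by (rule cut_at_pos[OF cuts(1) ante ranked_Suc]) auto
  then have all: "ranked X (Suc k) (image_mset conseq N + \<Gamma>)"
    by (rule cut_atD[OF cuts(2) _ conseq, where s = "positive x"]) (auto simp: conseq_def)
  \<comment> \<open>The consequents in front of \<open>\<Gamma>\<close> are removed one at a time,
    each by a detachment on its literal, which lies in \<open>\<Gamma>\<close>.\<close>
  have "ranked X (Suc k) \<Gamma>" if "ranked X (Suc k) (image_mset conseq K + \<Gamma>)" "K \<subseteq># N" for K
    using that
  proof (induction K)
    case (add y K)
    then have "y \<in># N" "K \<subseteq># N"
      by (auto dest: mset_subset_eq_insertD subset_mset.less_imp_le)
    then have lit: "lit y \<in># \<Gamma>"
      using mset_subset_eqD[OF sub, of "lit y"] by auto
    have "ranked X (Suc k) (image_mset conseq K + \<Gamma>)"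
    proof (rule ranked.detach[OF \<open>MP \<in> X\<close>, of y])
      show "ranked X (Suc k) (add_mset (ante y) (image_mset conseq K + \<Gamma>))"
        by (rule antes[OF \<open>y \<in># N\<close>])
      show "ranked X (Suc k) (add_mset (conseq y) (image_mset conseq K + \<Gamma>))"
        using add.prems by simp
    qed (use pos lit \<open>y \<in># N\<close> in auto)
    then show ?case using add.IH \<open>K \<subseteq># N\<close> by blast
  qed simp
  then show ?thesis using all by blast
qed

text \<open>Two conditional steps merge. Both heads are equivalent to \<open>C\<close>, hence to
  each other by cuts at rank \<open>k\<close>, and a cut on \<open>D\<close> joins the consequent
  premises. The new head is \<open>h'\<close>: the cut literal may be \<open>h\<close> itself,
  whereas \<open>h'\<close> is positive and so lies in \<open>N'\<close>.\<close>

lemma cond_premises_cut: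
  assumes low: "\<And>A :: 'v fm. cut_at X k A"
    and left: "cond_premises X k h (add_mset (C :: 'v fm, D, True) N)"
    and right: "cond_premises X k h' (add_mset (C, D, False) N')"
  shows "cond_premises X k h' (N + N')"
proof -
  have eq: "ranked X k {#\<^bold>\<not> ante h, ante y#}" "ranked X k {#\<^bold>\<not> ante y, ante h#}"
    if "y \<in># N" for y
    using left that by (simp_all add: cond_premises_def)
  have eq': "ranked X k {#\<^bold>\<not> ante h', ante y#}" "ranked X k {#\<^bold>\<not> ante y, ante h'#}"
    if "y \<in># N'" for y
    using right that by (simp_all add: cond_premises_def)
  have hC: "ranked X k {#\<^bold>\<not> ante h, C#}" and Ch: "ranked X k {#\<^bold>\<not> C, ante h#}"
    using left by (simp_all add: cond_premises_def)
  have h'C: "ranked X k {#\<^bold>\<not> ante h', C#}" and Ch': "ranked X k {#\<^bold>\<not> C, ante h'#}"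
    using right by (simp_all add: cond_premises_def)
  have hh': "ranked X k {#\<^bold>\<not> ante h, ante h'#}"
    by (rule cut_at_pos[OF low hC Ch']) auto
  have h'h: "ranked X k {#\<^bold>\<not> ante h', ante h#}"
    by (rule cut_at_pos[OF low h'C Ch]) auto
  have "ranked X k {#\<^bold>\<not> ante h', ante y#}" if "y \<in># N" for y
    by (rule cut_at_pos[OF low[of "ante h"] h'h eq(1)[OF that]]) auto
  moreover have "ranked X k {#\<^bold>\<not> ante y, ante h'#}" if "y \<in># N" for y
    by (rule cut_at_pos[OF low[of "ante h"] eq(2)[OF that] hh']) auto
  ultimately have "\<forall>y\<in>#N + N'. ranked X k {#\<^bold>\<not> ante h', ante y#} \<and> ranked X k {#\<^bold>\<not> ante y, ante h'#}"
    using eq' by auto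
  moreover have "ranked X k (id_part X (ante h') + image_mset conseq (N + N'))"
  proof -
    have "ranked X k (id_part X (ante h) + image_mset conseq (add_mset (C, D, True) N))"
      using left by (simp add: cond_premises_def)
    then have 1: "ranked X k (id_part X (ante h') + image_mset conseq (add_mset (C, D, True) N))"
    proof (cases "ID \<in> X")
      case True
      assume "ranked X k (id_part X (ante h) + image_mset conseq (add_mset (C, D, True) N))"
      then show ?thesis
        by (rule cut_at_pos[OF low[of "ante h"] h'h]) (use True in \<open>auto simp: id_part_def\<close>)
    qed (simp add: id_part_def)
    have 2: "ranked X k (id_part X (ante h') + image_mset conseq (add_mset (C, D, False) N'))"
      using right by (simp add: cond_premises_def)
    show ?thesis
      by (rule cut_at_pos[OF low[of D] 1 2]) (auto simp: conseq_def signed_def)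
  qed
  moreover have "CEM \<in> X \<or> size (filter_mset positive (N + N')) = 1"
  proof (cases "CEM \<in> X")
    case False
    \<comment> \<open>The left step spends its single positive literal on the cut, so the merged
      instance has exactly the positives of the right one.\<close>
    then have "filter_mset positive N = {#}"
      using cond_premises_other_positive[OF left] by (subst filter_mset_eq_mempty_iff) blast
    then show ?thesis
      using right by (simp add: cond_premises_def del: filter_mset_eq_mempty_iff)
  qed simp
  ultimately show ?thesis
    using right by (auto simp: cond_premises_def)
qed

text \<open>The conditional is traced through the left derivation and, wherever it is principal, its
  negation is traced through the right one. Two conditional steps need
  \<open>cond_premises_cut\<close>, the two mixed pairs \<open>detach_cond_premises\<close>, and two
  detachments just a cut on \<open>D\<close>.\<close>

lemma cut_at_cond:
  fixes C D :: "'v fm"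
  assumes low: "\<And>k (A :: 'v fm). n = Suc k \<Longrightarrow> cut_at X k A" and cuts: "cut_at X n C" "cut_at X n D"
  shows "cut_at X n (C \<^bold>\<leadsto> D)"
proof -
  \<comment> \<open>\<open>G\<close> replaces the traced negation. If that negation is principal in
    an axiom, its partner is in the context and \<open>base\<close>, possibly followed by a double
    negation, closes the branch.\<close>
  have right: "ranked X n (\<Delta> + G)"
    if der: "ranked X n (add_mset (\<^bold>\<not> (C \<^bold>\<leadsto> D)) \<Delta>)" and base: "ranked X n (add_mset (C \<^bold>\<leadsto> D) G)"
      and cnd: "\<And>\<Gamma> k h N. n = Suc k \<Longrightarrow> cond_premises X k h (add_mset (C, D, False) N)
        \<Longrightarrow> image_mset lit N \<subseteq># \<Gamma> \<Longrightarrow> ranked X n (\<Gamma> + G)"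
      and det: "\<And>\<Gamma>. MP \<in> X \<Longrightarrow> ranked X n (add_mset C (\<Gamma> + G))
        \<Longrightarrow> ranked X n (add_mset (\<^bold>\<not> D) (\<Gamma> + G)) \<Longrightarrow> ranked X n (\<Gamma> + G)"
    for \<Delta> G
  proof (rule replace_formula[OF der, of "{}"])
    show "ranked X n (\<Gamma> + G)" if "\<^bold>\<not> (\<^bold>\<not> (C \<^bold>\<leadsto> D)) \<in># \<Gamma>" for \<Gamma>
      using that by (intro ranked_structural[OF ranked.neg_neg[OF base]]) auto
    show "ranked X n (\<Gamma> + G)" if "\<^bold>\<not> (C \<^bold>\<leadsto> D) = \<^bold>\<not> A" "A \<in># \<Gamma>" for \<Gamma> A
      using that by (intro ranked_structural[OF base]) auto
    show "ranked X n (\<Gamma> + G)"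
      if "n = Suc k" "\<^bold>\<not> (C \<^bold>\<leadsto> D) = lit x" "cond_premises X k h (add_mset x N)"
        "image_mset lit N \<subseteq># \<Gamma>" for \<Gamma> k h x N
      using cnd[of k h N \<Gamma>] that by (metis lit_eq_simps(9))
    show "ranked X n (\<Gamma> + G)"
      if "MP \<in> X" "\<^bold>\<not> (C \<^bold>\<leadsto> D) = lit x" "ranked X n (add_mset (ante x) (\<Gamma> + G))"
        "ranked X n (add_mset (conseq x) (\<Gamma> + G))" for \<Gamma> x
    proof -
      have "x = (C, D, False)" using that(2) by (metis lit_eq_simps(9))
      then show ?thesis using det that by (simp add: conseq_def signed_def)
    qed
  qed auto
  show ?thesis
    unfolding cut_at_def
  proof (intro allI impI)
    fix \<Gamma>\<^sub>0 \<Delta>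
    assume l: "ranked X n (add_mset (C \<^bold>\<leadsto> D) \<Gamma>\<^sub>0)" and r: "ranked X n (add_mset (\<^bold>\<not> (C \<^bold>\<leadsto> D)) \<Delta>)"
    show "ranked X n (\<Gamma>\<^sub>0 + \<Delta>)"
    proof (rule replace_formula[OF l, of "{}"])
      show "ranked X n (\<Gamma> + \<Delta>)" if "\<^bold>\<not> (C \<^bold>\<leadsto> D) \<in># \<Gamma>" for \<Gamma>
        using that by (intro ranked_structural[OF r]) auto
      show "ranked X n (\<Gamma> + \<Delta>)"
        if n: "n = Suc k" and "(C \<^bold>\<leadsto> D) = lit x" and "cond_premises X k h (add_mset x N)"
          and sub: "image_mset lit N \<subseteq># \<Gamma>" for \<Gamma> k h x N
      proof -
        have x: "x = (C, D, True)" using that(2) by (metis lit_eq_simps(8))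
        then have prems: "cond_premises X k h (add_mset (C, D, True) N)" using that by simp
        have neg: "\<forall>y\<in>#N. positive y \<longrightarrow> CEM \<in> X"
          using cond_premises_other_positive[OF prems] by blast
        have "ranked X n (\<Delta> + \<Gamma>)"
        proof (rule right[OF r])
          \<comment> \<open>Reapplying the instance at which the left trace stopped yields the cut
            formula over \<open>\<Gamma>\<close>.\<close>
          show "ranked X n (add_mset (C \<^bold>\<leadsto> D) \<Gamma>)"
            unfolding n by (rule ranked_condI[OF prems]) (use sub in \<open>simp add: lit_def signed_def\<close>)
          show "ranked X n (\<Gamma>' + \<Gamma>)"
            if "n = Suc k'" "cond_premises X k' h' (add_mset (C, D, False) N')"
              "image_mset lit N' \<subseteq># \<Gamma>'" for \<Gamma>' k' h' N'
          proof -
            have "cond_premises X k h' (N + N')"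
              using cond_premises_cut[OF low prems] that n by auto
            then show ?thesis
              unfolding n using that(3) sub
              by (intro ranked_condI) (auto simp: add.commute intro: subset_mset.add_mono)
          qed
          show "ranked X n (\<Gamma>' + \<Gamma>)"
            if "MP \<in> X" "ranked X n (add_mset C (\<Gamma>' + \<Gamma>))"
              "ranked X n (add_mset (\<^bold>\<not> D) (\<Gamma>' + \<Gamma>))" for \<Gamma>'
            unfolding n
            by (rule detach_cond_premises[OF that(1) prems neg])
              (use low cuts that n sub in \<open>auto simp: signed_def intro: subset_mset.add_increasing\<close>)
        qed
        then show ?thesis by (simp add: add.commute)
      qed
      show "ranked X n (\<Gamma> + \<Delta>)"
        if "MP \<in> X" "positive x \<longrightarrow> CEM \<in> X" "(C \<^bold>\<leadsto> D) = lit x" "ranked X n (add_mset (ante x) (\<Gamma> + \<Delta>))"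
          "ranked X n (add_mset (conseq x) (\<Gamma> + \<Delta>))" for \<Gamma> x
      proof -
        have x: "x = (C, D, True)" using that(3) by (metis lit_eq_simps(8))
        have CEM: "CEM \<in> X" using that x by simp
        have C: "ranked X n (add_mset C (\<Gamma> + \<Delta>))" and D: "ranked X n (add_mset D (\<Gamma> + \<Delta>))"
          using that x by (auto simp: conseq_def signed_def)
        \<comment> \<open>The premises of the detachment already carry \<open>\<Delta>\<close>,
          because the cut formula has been replaced in them; the second copy is contracted at the
          end.\<close>
        have "ranked X n (\<Delta> + (\<Gamma> + \<Delta>))"
        proof (rule right[OF r])
          show "ranked X n (add_mset (C \<^bold>\<leadsto> D) (\<Gamma> + \<Delta>))"
          proof (rule ranked.detach[OF \<open>MP \<in> X\<close>, of x])
            show "ranked X n (add_mset (ante x) (add_mset (C \<^bold>\<leadsto> D) (\<Gamma> + \<Delta>)))"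
              by (rule ranked_structural[OF C]) (auto simp: x)
            show "ranked X n (add_mset (conseq x) (add_mset (C \<^bold>\<leadsto> D) (\<Gamma> + \<Delta>)))"
              by (rule ranked_structural[OF D]) (auto simp: x conseq_def signed_def)
          qed (simp_all add: x CEM lit_def signed_def)
          show "ranked X n (\<Gamma>' + (\<Gamma> + \<Delta>))"
            if "n = Suc k'" "cond_premises X k' h' (add_mset (C, D, False) N')"
              "image_mset lit N' \<subseteq># \<Gamma>'" for \<Gamma>' k' h' N'
          proof -
            have "ranked X n (add_mset C (\<Gamma>' + (\<Gamma> + \<Delta>)))" "ranked X n (add_mset D (\<Gamma>' + (\<Gamma> + \<Delta>)))"
              by (rule ranked_structural[OF C] ranked_structural[OF D]; auto)+
            then show ?thesis
              unfolding that(1)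
              by (rule_tac detach_cond_premises[OF \<open>MP \<in> X\<close> that(2)])
                (use low cuts that CEM in \<open>auto simp: signed_def intro: subset_mset.add_increasing2\<close>)
          qed
          show "ranked X n (\<Gamma>' + (\<Gamma> + \<Delta>))" if "ranked X n (add_mset (\<^bold>\<not> D) (\<Gamma>' + (\<Gamma> + \<Delta>)))" for \<Gamma>'
            by (rule cut_at_pos[OF cuts(2) D that]) auto
        qed
        then show ?thesis by (rule ranked_structural) auto
      qed
    qed auto
  qed
qed

lemma ranked_cut: "cut_at X n (A :: 'a fm)"
proof (induction n arbitrary: A rule: less_induct)
  case (less n)
  have low: "\<And>k (A :: 'a fm). n = Suc k \<Longrightarrow> cut_at X k A"
    using less.IH by blast
  show ?case
  proof (induction A)
    case Bot
    \<comment> \<open>Falsum is simply deleted: it is principal only in an axiom, and the partner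
      \<open>Neg Bot\<close> closes that sequent alone.\<close>
    have "ranked X n (\<Gamma> + {#})" if "ranked X n (add_mset \<^bold>\<bottom> \<Gamma>)" for \<Gamma> :: "'a sequent"
      by (rule replace_formula[OF that, of "{}"]) (auto intro: ranked.neg_bot)
    then show ?case by (auto simp: cut_at_def intro: ranked_weaken)
  next
    case (Var p)
    have "ranked X n (\<Gamma> + \<Delta>)"
      if l: "ranked X n (add_mset (Var p) \<Gamma>)" and r: "ranked X n (add_mset (\<^bold>\<not> Var p) \<Delta>)" for \<Gamma> \<Delta>
    proof (rule replace_formula[OF l, of "{}"])
      show "ranked X n (\<Gamma> + \<Delta>)" if "\<^bold>\<not> Var p \<in># \<Gamma>" for \<Gamma>
        using that by (intro ranked_structural[OF r]) auto
    qed auto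
    then show ?case by (simp add: cut_at_def)
  next
    case (Neg A)
    have "ranked X n (\<Gamma> + \<Delta>)"
      if l: "ranked X n (add_mset (\<^bold>\<not> A) \<Gamma>)" and r: "ranked X n (add_mset (\<^bold>\<not> (\<^bold>\<not> A)) \<Delta>)" for \<Gamma> \<Delta>
      \<comment> \<open>Inverting the double negation exchanges the two sides of the cut.\<close>
      by (rule cut_at_pos[OF Neg invert_neg_neg[OF r] l]) auto
    then show ?case by (simp add: cut_at_def)
  next
    case (And A B)
    have "ranked X n (\<Gamma> + \<Delta>)"
      if l: "ranked X n (add_mset (A \<^bold>\<and> B) \<Gamma>)" and r: "ranked X n (add_mset (\<^bold>\<not> (A \<^bold>\<and> B)) \<Delta>)" for \<Gamma> \<Delta>
    proof -
      have "ranked X n (add_mset (\<^bold>\<not> B) (\<Gamma> + \<Delta>))"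
        by (rule cut_at_pos[OF And(1) invert_and(1)[OF l] invert_neg_and[OF r]]) auto
      then show ?thesis
        by (rule cut_at_pos[OF And(2) invert_and(2)[OF l]]) auto
    qed
    then show ?case by (simp add: cut_at_def)
  next
    case (Cond A B)
    then show ?case using cut_at_cond low by blast
  qed
qed

subsection \<open>Ranked and unranked derivability\<close>

text \<open>All four conditional rule sets at once: at \<open>j = 0\<close> the CEM rule has one
  positive conditional and is the ordinary rule, and \<open>id_part\<close> carries the extra
  formula of ID.\<close>

definition cond_rules :: "cond_axiom set \<Rightarrow> 'v seqrule set" where
  "cond_rules X = {(eq_prems A n @
       [id_part X (A 0) + ({#B i. i \<in># mset_set {0..j}#} + {#\<^bold>\<not> B i. i \<in># mset_set {j+1..n}#})],
      {#A i \<^bold>\<leadsto> B i. i \<in># mset_set {0..j}#} + {#\<^bold>\<not> (A i \<^bold>\<leadsto> B i). i \<in># mset_set {j+1..n}#} + \<Gamma>)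
    |A B j n \<Gamma>. j \<le> n \<and> (CEM \<in> X \<or> j = 0)}"

lemma gentzen_rules_eq:
  "(gentzen_rules X :: 'v seqrule set) = cond_rules X \<union> (if MP \<in> X then MPg else {})
     \<union> (if MP \<in> X \<and> CEM \<in> X then MPCEMg else {})"
proof -
  have "(if CEM \<in> X then if ID \<in> X then CKCEMIDg else CKCEMg else if ID \<in> X then CKIDg else CKg)
      = (cond_rules X :: 'v seqrule set)"
    by (simp add: cond_rules_def CKCEMIDg_def CKCEMg_def CKIDg_def CKg_def id_part_def add_mset_commute)
  then show ?thesis by (simp add: gentzen_rules_def)
qed

lemma image_mset_split_at:
  fixes j n :: nat
  assumes "j \<le> n"
  shows "image_mset f (mset_set {0..j}) + image_mset g (mset_set {j+1..n})
    = image_mset (\<lambda>i. if i \<le> j then f i else g i) (mset_set {0..n})"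
proof -
  have "{0..n} = {0..j} \<union> {j+1..n}" using assms by auto
  then have "mset_set {0..n} = mset_set {0..j} + mset_set {j+1..n}"
    by (simp add: mset_set_Union)
  then show ?thesis by (auto intro!: arg_cong2[where f = "(+)"] image_mset_cong)
qed

lemma indexed_conds:
  fixes j n :: nat
  assumes "j \<le> n" and M: "M = {#(A i, B i, i \<le> j). i \<in># mset_set {0..n}#}"
  shows "{#A i \<^bold>\<leadsto> B i. i \<in># mset_set {0..j}#} + {#\<^bold>\<not> (A i \<^bold>\<leadsto> B i). i \<in># mset_set {j+1..n}#}
      = image_mset lit M"
    and "{#B i. i \<in># mset_set {0..j}#} + {#\<^bold>\<not> B i. i \<in># mset_set {j+1..n}#} = image_mset conseq M"
  by (simp_all add: assms(2) image_mset_split_at[OF assms(1), simplified] multiset.map_comp comp_def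
      lit_def conseq_def signed_def)

lemma set_eq_prems:
  "set (eq_prems A n) = (\<Union>i\<in>{1..n}. {{#\<^bold>\<not> A 0, A i#}, {#\<^bold>\<not> A i, A 0#}})"
  by (auto simp: eq_prems_def atLeastLessThanSuc_atLeastAtMost simp del: upt_Suc)

lemma ranked_of_gentzen: "gentzen (gentzen_rules X) S \<Longrightarrow> \<exists>n. ranked X n S"
proof (induction rule: gentzen.induct)
  case (ax A \<Gamma>)
  have "ranked X 0 ({#A, \<^bold>\<not> A#} + \<Gamma>)" by (rule ranked.ax[of A]) auto
  then show ?case ..
next
  case (neg_bot \<Gamma>)
  have "ranked X 0 ({#\<^bold>\<not> \<^bold>\<bottom>#} + \<Gamma>)" by (rule ranked.neg_bot) auto
  then show ?case ..
next
  case (neg_and \<Gamma> A B)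
  then show ?case using ranked.neg_and[of X _ A B \<Gamma>] by (auto simp: add_mset_commute)
next
  case (and_intro \<Gamma> A B)
  then obtain n m where "ranked X n (\<Gamma> + {#A#})" "ranked X m (\<Gamma> + {#B#})" by blast
  then have "ranked X (max n m) (add_mset A \<Gamma>)" "ranked X (max n m) (add_mset B \<Gamma>)"
    by (auto elim: ranked_mono)
  then have "ranked X (max n m) (\<Gamma> + {#A \<^bold>\<and> B#})"
    by (simp add: ranked.and_intro)
  then show ?case ..
next
  case (neg_neg \<Gamma> A)
  then show ?case using ranked.neg_neg[of X _ A \<Gamma>] by auto
next
  case (rule \<Gamma>s \<Gamma>\<^sub>0)
  then have "\<forall>\<Gamma>\<in>set \<Gamma>s. \<exists>n. ranked X n \<Gamma>" by blast
  then obtain r where "\<forall>\<Gamma>\<in>set \<Gamma>s. ranked X (r \<Gamma>) \<Gamma>" by metis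
  \<comment> \<open>A rule has finitely many premises, so one rank serves them all.\<close>
  then have "\<forall>\<Gamma>\<in>set \<Gamma>s. ranked X (Max (r ` set \<Gamma>s)) \<Gamma>"
    by (auto intro: ranked_mono)
  then obtain k where k: "\<forall>\<Gamma>\<in>set \<Gamma>s. ranked X k \<Gamma>" ..
  consider "(\<Gamma>s, \<Gamma>\<^sub>0) \<in> cond_rules X" | "MP \<in> X" "(\<Gamma>s, \<Gamma>\<^sub>0) \<in> MPg"
    | "MP \<in> X" "CEM \<in> X" "(\<Gamma>s, \<Gamma>\<^sub>0) \<in> MPCEMg"
    using rule.hyps by (auto simp: gentzen_rules_eq split: if_splits)
  then show ?case
  proof cases
    case 1
    then obtain A B j n \<Gamma> where jn: "j \<le> n" and j: "CEM \<in> X \<or> j = 0"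
      and \<Gamma>s: "\<Gamma>s = eq_prems A n @
       [id_part X (A 0) + ({#B i. i \<in># mset_set {0..j}#} + {#\<^bold>\<not> B i. i \<in># mset_set {j+1..n}#})]"
      and \<Gamma>\<^sub>0: "\<Gamma>\<^sub>0 = {#A i \<^bold>\<leadsto> B i. i \<in># mset_set {0..j}#}
        + {#\<^bold>\<not> (A i \<^bold>\<leadsto> B i). i \<in># mset_set {j+1..n}#} + \<Gamma>"
      unfolding cond_rules_def by blast
    define M where "M = {#(A i, B i, i \<le> j). i \<in># mset_set {0..n}#}"
    note conds = indexed_conds[OF jn M_def]
    have "cond_premises X k (A 0, B 0, True) M"
      unfolding cond_premises_def
    proof (intro conjI ballI)
      show "(A 0, B 0, True) \<in># M" by (auto simp: M_def intro!: image_eqI[where x = 0])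
      have "filter_mset positive M = {#(A i, B i, i \<le> j). i \<in># mset_set {0..j}#}"
      proof -
        have "{i \<in> {0..n}. i \<le> j} = {0..j}" using jn by auto
        then show ?thesis by (simp add: M_def filter_mset_image_mset comp_def)
      qed
      then show "CEM \<in> X \<or> size (filter_mset positive M) = 1" using j by auto
      show "ranked X k (id_part X (ante (A 0, B 0, True)) + image_mset conseq M)"
        using k by (simp add: \<Gamma>s conds(2)[symmetric])
      fix x assume "x \<in># M"
      then obtain i where i: "i \<le> n" "ante x = A i" by (auto simp: M_def)
      \<comment> \<open>\<open>eq_prems\<close> has no entry for index 0; the sequents required
        there are axioms.\<close>
      show "ranked X k {#\<^bold>\<not> ante (A 0, B 0, True), ante x#}"
        using k i by (cases "i = 0") (auto simp: \<Gamma>s set_eq_prems intro: ranked.ax[of "A 0"])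
      show "ranked X k {#\<^bold>\<not> ante x, ante (A 0, B 0, True)#}"
        using k i by (cases "i = 0") (auto simp: \<Gamma>s set_eq_prems intro: ranked.ax[of "A 0"])
    qed simp
    then have "ranked X (Suc k) \<Gamma>\<^sub>0"
      by (rule ranked_condI) (simp add: \<Gamma>\<^sub>0 conds(1)[symmetric])
    then show ?thesis ..
  next
    case 2
    then obtain A B \<Gamma> where "\<Gamma>s = [{#A, \<^bold>\<not> (A \<^bold>\<leadsto> B)#} + \<Gamma>, {#\<^bold>\<not> B, \<^bold>\<not> (A \<^bold>\<leadsto> B)#} + \<Gamma>]"
      "\<Gamma>\<^sub>0 = {#\<^bold>\<not> (A \<^bold>\<leadsto> B)#} + \<Gamma>" unfolding MPg_def by blast
    with k 2 have "ranked X k \<Gamma>\<^sub>0"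
      by (intro ranked.detach[of X "(A, B, False)" \<Gamma>\<^sub>0 k]) (auto simp: lit_def conseq_def signed_def)
    then show ?thesis ..
  next
    case 3
    then obtain A B \<Gamma> where "\<Gamma>s = [{#A, A \<^bold>\<leadsto> B#} + \<Gamma>, {#B, A \<^bold>\<leadsto> B#} + \<Gamma>]"
      "\<Gamma>\<^sub>0 = {#A \<^bold>\<leadsto> B#} + \<Gamma>" unfolding MPCEMg_def by blast
    with k 3 have "ranked X k \<Gamma>\<^sub>0"
      by (intro ranked.detach[of X "(A, B, True)" \<Gamma>\<^sub>0 k]) (auto simp: lit_def conseq_def signed_def)
    then show ?thesis ..
  qed
qed

lemma gentzen_ax: "A \<in># S \<Longrightarrow> \<^bold>\<not> A \<in># S \<Longrightarrow> gentzen R S"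
proof -
  assume "A \<in># S" "\<^bold>\<not> A \<in># S"
  \<comment> \<open>The two formulas are distinct, so both can be split off the multiset
    together.\<close>
  moreover have "\<^bold>\<not> A \<noteq> A" by (induction A) auto
  ultimately obtain K where "S = {#A, \<^bold>\<not> A#} + K"
    by (metis add_mset_add_single insert_noteq_member multi_member_split union_mset_add_mset_left
        add_0)
  then show ?thesis using gentzen.ax by simp
qed

lemma gentzen_neg_bot: "\<^bold>\<not> \<^bold>\<bottom> \<in># S \<Longrightarrow> gentzen R S"
  using gentzen.neg_bot[of R] by (metis add_0 multi_member_split union_mset_add_mset_left)

lemma gentzen_cond:
  assumes M: "h \<in># M" "positive h" "CEM \<in> X \<or> size (filter_mset positive M) = 1"
    and eq: "\<And>x. x \<in># M \<Longrightarrow> gentzen (gentzen_rules X) {#\<^bold>\<not> ante h, ante x#}"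
      "\<And>x. x \<in># M \<Longrightarrow> gentzen (gentzen_rules X) {#\<^bold>\<not> ante x, ante h#}"
    and conseq: "gentzen (gentzen_rules X) (id_part X (ante h) + image_mset conseq M)"
    and sub: "image_mset lit M \<subseteq># S"
  shows "gentzen (gentzen_rules X) S"
proof -
  obtain N where N: "M = add_mset h N" using M(1) by (metis multi_member_split)
  obtain ps where ps: "mset ps = filter_mset positive N" using ex_mset by blast
  obtain ns where ns: "mset ns = filter_mset (\<lambda>x. \<not> positive x) N" using ex_mset by blast
  \<comment> \<open>Head first, then the other positives, then the negatives: position
    \<open>i\<close> is positive exactly when \<open>i \<le> j\<close>, where \<open>j\<close> does
    not count the head.\<close>
  define zs where "zs = h # ps @ ns"
  define j where "j = length ps"
  define n where "n = length ps + length ns"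
  define A where "A = (\<lambda>i. ante (zs ! i))"
  define B where "B = (\<lambda>i. fst (snd (zs ! i)))"
  have jn: "j \<le> n" by (simp add: j_def n_def)
  have len: "length zs = Suc n" by (simp add: zs_def n_def)
  have zsM: "mset zs = M"
    by (simp add: zs_def N ps ns flip: multiset_partition)
  have in_ps: "x \<in> set ps \<Longrightarrow> positive x" and in_ns: "x \<in> set ns \<Longrightarrow> \<not> positive x" for x
    using ps ns by (metis filter_mset_eq_conv set_mset_filter mem_Collect_eq set_mset_mset)+
  have nth: "(A i, B i, i \<le> j) = zs ! i" if "i \<le> n" for i
  proof (cases i)
    case 0
    then show ?thesis using M(2) by (cases h) (simp add: A_def B_def zs_def)
  next
    case (Suc l)
    then have "positive (zs ! i) \<longleftrightarrow> i \<le> j"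
      using that in_ps in_ns by (auto simp: zs_def j_def n_def nth_append)
    then show ?thesis by (simp add: A_def B_def prod_eq_iff)
  qed
  have "M = mset (map (\<lambda>i. zs ! i) [0..<length zs])"
    by (simp add: map_nth zsM)
  also have "\<dots> = {#zs ! i. i \<in># mset_set {0..n}#}"
    by (simp add: len atLeastLessThanSuc_atLeastAtMost del: upt_Suc)
  also have "\<dots> = {#(A i, B i, i \<le> j). i \<in># mset_set {0..n}#}"
    using nth by (intro image_mset_cong) auto
  finally have M_eq: "M = {#(A i, B i, i \<le> j). i \<in># mset_set {0..n}#}" .
  note conds = indexed_conds[OF jn M_eq]
  have A0: "A 0 = ante h" by (simp add: A_def zs_def)
  have Ai: "\<exists>x\<in>#M. A i = ante x" if "i \<le> n" for i
    using that len zsM by (metis A_def le_imp_less_Suc nth_mem set_mset_mset)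
  \<comment> \<open>Without CEM the head is the only positive member, so \<open>ps\<close> is
    empty.\<close>
  have "CEM \<in> X \<or> j = 0"
    using M(2,3) ps by (auto simp: N j_def simp flip: size_mset)
  then have "(eq_prems A n @ [id_part X (A 0) + image_mset conseq M],
      image_mset lit M + (S - image_mset lit M)) \<in> gentzen_rules X"
    unfolding gentzen_rules_eq cond_rules_def conds[symmetric] using jn by blast
  moreover have "\<forall>\<Gamma>\<in>set (eq_prems A n @ [id_part X (A 0) + image_mset conseq M]).
      gentzen (gentzen_rules X) \<Gamma>"
    using Ai eq conseq by (fastforce simp: set_eq_prems A0)
  ultimately have "gentzen (gentzen_rules X) (image_mset lit M + (S - image_mset lit M))"
    by (rule gentzen.rule)
  then show ?thesis using sub by simp
qed

lemma gentzen_detach: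
  assumes "MP \<in> X" "positive x \<longrightarrow> CEM \<in> X" "lit x \<in># S"
    and "gentzen (gentzen_rules X) (add_mset (ante x) S)"
    and "gentzen (gentzen_rules X) (add_mset (conseq x) S)"
  shows "gentzen (gentzen_rules X) S"
proof -
  obtain A B s where x: "x = (A, B, s)" by (cases x)
  obtain \<Gamma> where \<Gamma>: "S = {#lit x#} + \<Gamma>"
    using assms(3) by (metis add_0 multi_member_split union_mset_add_mset_left)
  have "([{#A, lit x#} + \<Gamma>, {#conseq x, lit x#} + \<Gamma>], {#lit x#} + \<Gamma>) \<in> gentzen_rules X"
  proof (cases s)
    case True
    have "([{#A, lit x#} + \<Gamma>, {#conseq x, lit x#} + \<Gamma>], {#lit x#} + \<Gamma>) \<in> MPCEMg"
      unfolding MPCEMg_def x lit_def conseq_def signed_def using True by auto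
    then show ?thesis using assms(1,2) x True by (simp add: gentzen_rules_eq)
  next
    case False
    have "([{#A, lit x#} + \<Gamma>, {#conseq x, lit x#} + \<Gamma>], {#lit x#} + \<Gamma>) \<in> MPg"
      unfolding MPg_def x lit_def conseq_def signed_def using False by auto
    then show ?thesis using assms(1) by (simp add: gentzen_rules_eq)
  qed
  moreover have "\<forall>\<Delta>\<in>set [{#A, lit x#} + \<Gamma>, {#conseq x, lit x#} + \<Gamma>]. gentzen (gentzen_rules X) \<Delta>"
    using assms(4,5) by (auto simp: \<Gamma> x)
  ultimately show ?thesis unfolding \<Gamma> by (rule gentzen.rule)
qed

lemma gentzen_of_ranked: "ranked X n S \<Longrightarrow> gentzen (gentzen_rules X) S"
proof (induction rule: ranked.induct)
  case (ax A S n)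
  then show ?case by (rule gentzen_ax)
next
  case (neg_bot S n)
  then show ?case by (rule gentzen_neg_bot)
next
  case (neg_and n A B \<Gamma>)
  then show ?case using gentzen.neg_and[of _ \<Gamma> A B] by (simp add: add_mset_commute)
next
  case (and_intro n A \<Gamma> B)
  then show ?case using gentzen.and_intro[of _ \<Gamma> A B] by simp
next
  case (neg_neg n A \<Gamma>)
  then show ?case using gentzen.neg_neg[of _ \<Gamma> A] by simp
next
  case (cond h M n S)
  then show ?case by (intro gentzen_cond[of h M X S]) blast+
next
  case (detach x S n)
  then show ?case by (intro gentzen_detach[of X x S])
qed

lemma gentzen_iff_ranked: "gentzen (gentzen_rules X) S \<longleftrightarrow> (\<exists>n. ranked X n S)"
  using ranked_of_gentzen gentzen_of_ranked by blast

section \<open>Cut, structural rules and invertibility in the original calculus\<close>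

lemma gentzen_cut:
  assumes "gentzen (gentzen_rules X) (add_mset A \<Gamma>)" "gentzen (gentzen_rules X) (add_mset (\<^bold>\<not> A) \<Delta>)"
  shows "gentzen (gentzen_rules X) (\<Gamma> + \<Delta>)"
proof -
  obtain n m where "ranked X n (add_mset A \<Gamma>)" "ranked X m (add_mset (\<^bold>\<not> A) \<Delta>)"
    using assms by (auto simp: gentzen_iff_ranked)
  then have "ranked X (max n m) (add_mset A \<Gamma>)" "ranked X (max n m) (add_mset (\<^bold>\<not> A) \<Delta>)"
    by (auto elim: ranked_mono)
  then show ?thesis using ranked_cut unfolding cut_at_def gentzen_iff_ranked by blast
qed


lemma gentzen_structural:
  assumes "gentzen (gentzen_rules X) S" "set_mset S \<subseteq> set_mset T"
  shows "gentzen (gentzen_rules X) T"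
  using assms by (auto simp: gentzen_iff_ranked intro: ranked_structural)

text \<open>Inversion turns the propositional rules into equivalences, so that Hilbert formulas can
  be decomposed by rewriting.\<close>

lemma gentzen_neg_neg_iff [simp]:
  "gentzen (gentzen_rules X) (add_mset (\<^bold>\<not> (\<^bold>\<not> A)) \<Gamma>) \<longleftrightarrow> gentzen (gentzen_rules X) (add_mset A \<Gamma>)"
  by (auto simp: gentzen_iff_ranked intro: ranked.neg_neg invert_neg_neg)

lemma gentzen_neg_and_iff [simp]:
  "gentzen (gentzen_rules X) (add_mset (\<^bold>\<not> (A \<^bold>\<and> B)) \<Gamma>)
    \<longleftrightarrow> gentzen (gentzen_rules X) (add_mset (\<^bold>\<not> A) (add_mset (\<^bold>\<not> B) \<Gamma>))"
  by (auto simp: gentzen_iff_ranked intro: ranked.neg_and invert_neg_and)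

lemma gentzen_and_iff [simp]:
  "gentzen (gentzen_rules X) (add_mset (A \<^bold>\<and> B) \<Gamma>)
    \<longleftrightarrow> gentzen (gentzen_rules X) (add_mset A \<Gamma>) \<and> gentzen (gentzen_rules X) (add_mset B \<Gamma>)"
  using gentzen.and_intro[of "gentzen_rules X" \<Gamma> A B]
  by (auto simp: gentzen_iff_ranked intro: invert_and)

lemma gentzen_or_iff:
  "gentzen (gentzen_rules X) (add_mset (A \<^bold>\<or> B) \<Gamma>)
    \<longleftrightarrow> gentzen (gentzen_rules X) (add_mset A (add_mset B \<Gamma>))"
  \<comment> \<open>The equivalences match the outermost \<open>add_mset\<close> only; the
    commutations bring the second double negation there.\<close>
  by (simp add: add_mset_commute[of A "\<^bold>\<not> (\<^bold>\<not> B)"] add_mset_commute[of A B])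

lemma gentzen_imp_iff:
  "gentzen (gentzen_rules X) (add_mset (A \<^bold>\<longrightarrow> B) \<Gamma>)
    \<longleftrightarrow> gentzen (gentzen_rules X) (add_mset (\<^bold>\<not> A) (add_mset B \<Gamma>))"
  by (simp add: add_mset_commute[of "\<^bold>\<not> A"])

subsection \<open>Hilbert derivations\<close>

text \<open>The summand 2 makes a negated conjunction, of weight
  \<open>weight P + weight Q + 3\<close>, heavier than its two negated conjuncts together.\<close>

primrec weight :: "pform \<Rightarrow> nat" where
  "weight PBot = 0"
| "weight (PVar i) = 0"
| "weight (PNeg P) = Suc (weight P)"
| "weight (PAnd P Q) = weight P + weight Q + 2"

text \<open>Read upwards, the propositional rules preserve validity. Decomposing
  \<open>pform\<close> rather than its substitution instance stops at the letters, and a valid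
  sequent of signed letters and constants closes by \<open>neg_bot\<close> or by an axiom on some
  \<open>\<sigma> i\<close>.\<close>

lemma gentzen_tautology:
  "\<forall>v. \<exists>P\<in>#\<Gamma>. pform_val v P \<Longrightarrow> gentzen R (image_mset (pform_subst \<sigma>) \<Gamma>)"
proof (induction "\<Sum>P\<in>#\<Gamma>. weight P" arbitrary: \<Gamma> rule: less_induct)
  case less
  consider P Q K where "\<Gamma> = add_mset (PAnd P Q) K" | P Q K where "\<Gamma> = add_mset (PNeg (PAnd P Q)) K"
    | P K where "\<Gamma> = add_mset (PNeg (PNeg P)) K"
    | "\<forall>P\<in>#\<Gamma>. P = PBot \<or> P = PNeg PBot \<or> (\<exists>i. P = PVar i \<or> P = PNeg (PVar i))"
    by (metis multi_member_split pform.exhaust)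
  then show ?case
  proof cases
    case 1
    have "\<forall>v. \<exists>F\<in>#add_mset P K. pform_val v F" "\<forall>v. \<exists>F\<in>#add_mset Q K. pform_val v F"
      using less.prems 1 by fastforce+
    then have "gentzen R (image_mset (pform_subst \<sigma>) (add_mset P K))"
      "gentzen R (image_mset (pform_subst \<sigma>) (add_mset Q K))"
      using less.hyps[of "add_mset P K"] less.hyps[of "add_mset Q K"] 1 by simp_all
    then show ?thesis
      using gentzen.and_intro[of R "image_mset (pform_subst \<sigma>) K"] 1 by simp
  next
    case 2
    have "\<forall>v. \<exists>F\<in>#add_mset (PNeg P) (add_mset (PNeg Q) K). pform_val v F"
      using less.prems 2 by fastforce
    then have "gentzen R (image_mset (pform_subst \<sigma>) (add_mset (PNeg P) (add_mset (PNeg Q) K)))"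
      using less.hyps[of "add_mset (PNeg P) (add_mset (PNeg Q) K)"] 2 by simp
    then show ?thesis
      using gentzen.neg_and[of R "image_mset (pform_subst \<sigma>) K"] 2 by (simp add: add_mset_commute)
  next
    case 3
    have "\<forall>v. \<exists>F\<in>#add_mset P K. pform_val v F"
      using less.prems 3 by fastforce
    then have "gentzen R (image_mset (pform_subst \<sigma>) (add_mset P K))"
      using less.hyps[of "add_mset P K"] 3 by simp
    then show ?thesis
      using gentzen.neg_neg[of R "image_mset (pform_subst \<sigma>) K"] 3 by simp
  next
    case 4
    \<comment> \<open>Under this valuation every negated letter of \<open>\<Gamma>\<close> is false,
      and a letter is true only if its negation is in \<open>\<Gamma>\<close> as well.\<close>
    obtain P where P: "P \<in># \<Gamma>" "pform_val (\<lambda>i. PNeg (PVar i) \<in># \<Gamma>) P"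
      using less.prems by blast
    with 4 consider "P = PNeg PBot" | i where "P = PVar i" "PNeg (PVar i) \<in># \<Gamma>"
      by fastforce
    then show ?thesis
    proof cases
      case 1
      then show ?thesis using P(1) by (force intro: gentzen_neg_bot)
    next
      case 2
      then show ?thesis using P(1) by (force intro: gentzen_ax[of "\<sigma> i"])
    qed
  qed
qed

section \<open>Gentzen derivations of the conditional Hilbert rules and axioms\<close>

lemma gentzen_neg_conj_list_iff:
  "Bs \<noteq> [] \<Longrightarrow> gentzen (gentzen_rules X) (add_mset (\<^bold>\<not> conj_list Bs) \<Gamma>)
    \<longleftrightarrow> gentzen (gentzen_rules X) (image_mset Neg (mset Bs) + \<Gamma>)"
proof (induction Bs arbitrary: \<Gamma> rule: conj_list.induct)
  case (3 A B Bs)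
  have "gentzen (gentzen_rules X) (add_mset (\<^bold>\<not> conj_list (A # B # Bs)) \<Gamma>)
    \<longleftrightarrow> gentzen (gentzen_rules X) (add_mset (\<^bold>\<not> conj_list (B # Bs)) (add_mset (\<^bold>\<not> A) \<Gamma>))"
    by (simp add: add_mset_commute)
  then show ?case using 3(1)[of "add_mset (\<^bold>\<not> A) \<Gamma>"] by (simp add: add_mset_commute)
qed auto

lemma gentzen_conj_imp_iff:
  "gentzen (gentzen_rules X) {#conj_imp Bs B#}
    \<longleftrightarrow> gentzen (gentzen_rules X) (image_mset Neg (mset Bs) + {#B#})"
  using gentzen_neg_conj_list_iff[of Bs X "{#B#}"] by (auto simp: conj_imp_def gentzen_imp_iff simp del: gentzen_neg_and_iff)

lemma gentzen_congruence:
  assumes "gentzen (gentzen_rules X) {#\<^bold>\<not> A, A'#}" "gentzen (gentzen_rules X) {#\<^bold>\<not> A', A#}"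
  shows "gentzen (gentzen_rules X) {#\<^bold>\<not> (A \<^bold>\<leadsto> B), A' \<^bold>\<leadsto> B#}"
proof (rule gentzen_cond[of "(A', B, True)" "{#(A', B, True), (A, B, False)#}"])
  show "gentzen (gentzen_rules X) (id_part X (ante (A', B, True))
      + image_mset conseq {#(A', B, True), (A, B, False)#})"
    by (rule gentzen_ax[of B]) (auto simp: conseq_def signed_def)
qed (use assms in \<open>auto simp: lit_def signed_def intro: gentzen_ax[of A'] subset_mset.eq_refl\<close>)

lemma gentzen_normality:
  assumes "gentzen (gentzen_rules X) {#conj_imp Bs B#}"
  shows "gentzen (gentzen_rules X) {#conj_imp (map (\<lambda>C. A \<^bold>\<leadsto> C) Bs) (A \<^bold>\<leadsto> B)#}"
  unfolding gentzen_conj_imp_iff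
proof (rule gentzen_cond[of "(A, B, True)" "add_mset (A, B, True) {#(A, C, False). C \<in># mset Bs#}"])
  show "gentzen (gentzen_rules X) (id_part X (ante (A, B, True))
      + image_mset conseq (add_mset (A, B, True) {#(A, C, False). C \<in># mset Bs#}))"
    using assms unfolding gentzen_conj_imp_iff
    by (rule gentzen_structural) (auto simp: multiset.map_comp comp_def conseq_def signed_def)
  show "image_mset lit (add_mset (A, B, True) {#(A, C, False). C \<in># mset Bs#})
      \<subseteq># image_mset Neg (mset (map (\<lambda>C. A \<^bold>\<leadsto> C) Bs)) + {#A \<^bold>\<leadsto> B#}"
    by (simp add: multiset.map_comp comp_def lit_def signed_def)
qed (auto simp: filter_mset_image_mset intro: gentzen_ax[of A])

lemma gentzen_ID:
  assumes "ID \<in> X"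
  shows "gentzen (gentzen_rules X) {#A \<^bold>\<leadsto> A#}"
proof (rule gentzen_cond[of "(A, A, True)" "{#(A, A, True)#}"])
  show "gentzen (gentzen_rules X) (id_part X (ante (A, A, True)) + image_mset conseq {#(A, A, True)#})"
    by (rule gentzen_ax[of A]) (use assms in \<open>auto simp: id_part_def conseq_def signed_def\<close>)
qed (auto simp: lit_def signed_def intro: gentzen_ax[of A])

lemma gentzen_MP:
  assumes "MP \<in> X"
  shows "gentzen (gentzen_rules X) {#\<^bold>\<not> (A \<^bold>\<leadsto> B), \<^bold>\<not> A, B#}"
proof (rule gentzen_detach[OF assms, of "(A, B, False)"])
  show "gentzen (gentzen_rules X) (add_mset (ante (A, B, False)) {#\<^bold>\<not> (A \<^bold>\<leadsto> B), \<^bold>\<not> A, B#})"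
    by (rule gentzen_ax[of A]) auto
  show "gentzen (gentzen_rules X) (add_mset (conseq (A, B, False)) {#\<^bold>\<not> (A \<^bold>\<leadsto> B), \<^bold>\<not> A, B#})"
    by (rule gentzen_ax[of B]) (auto simp: conseq_def signed_def)
qed (auto simp: lit_def signed_def)

lemma gentzen_CEM:
  assumes "CEM \<in> X"
  shows "gentzen (gentzen_rules X) {#A \<^bold>\<leadsto> B, A \<^bold>\<leadsto> \<^bold>\<not> B#}"
proof (rule gentzen_cond[of "(A, B, True)" "{#(A, B, True), (A, \<^bold>\<not> B, True)#}"])
  show "gentzen (gentzen_rules X) (id_part X (ante (A, B, True))
      + image_mset conseq {#(A, B, True), (A, \<^bold>\<not> B, True)#})"
    by (rule gentzen_ax[of B]) (auto simp: conseq_def signed_def)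
qed (use assms in \<open>auto simp: lit_def signed_def intro: gentzen_ax[of A]\<close>)

lemma axiom_rules_cases:
  assumes "(\<Gamma>s, \<Gamma>) \<in> axiom_rules a"
  obtains A where "a = ID" "\<Gamma> = {#A \<^bold>\<leadsto> A#}"
  | A B where "a = MP" "\<Gamma> = {#(A \<^bold>\<leadsto> B) \<^bold>\<longrightarrow> (A \<^bold>\<longrightarrow> B)#}"
  | A B where "a = CEM" "\<Gamma> = {#(A \<^bold>\<leadsto> B) \<^bold>\<or> (A \<^bold>\<leadsto> \<^bold>\<not> B)#}"
  using assms by (cases a) auto

lemma gentzen_of_hilbert: "hilbert (hilbert_rules X) A \<Longrightarrow> gentzen (gentzen_rules X) {#A#}"
proof (induction rule: hilbert.induct)
  case (taut P \<sigma>)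
  then show ?case using gentzen_tautology[of "{#P#}"] by (simp add: tautology_def)
next
  case (modus_ponens A B)
  \<comment> \<open>The only place in this translation that needs cut: inverting the implication
    leaves \<open>Neg A, B\<close>.\<close>
  then show ?case using gentzen_cut[of X A "{#}" "{#B#}"] by (simp only: gentzen_imp_iff add_0)
next
  case (rule \<Gamma>s \<Gamma>\<^sub>0)
  then consider
      A A' B where "\<Gamma>s = [{#A \<^bold>\<longleftrightarrow> A'#}]" "\<Gamma>\<^sub>0 = {#(A \<^bold>\<leadsto> B) \<^bold>\<longleftrightarrow> (A' \<^bold>\<leadsto> B)#}"
    | A Bs B where "\<Gamma>s = [{#conj_imp Bs B#}]"
        "\<Gamma>\<^sub>0 = {#conj_imp (map (\<lambda>C. A \<^bold>\<leadsto> C) Bs) (A \<^bold>\<leadsto> B)#}"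
    | A where "ID \<in> X" "\<Gamma>\<^sub>0 = {#A \<^bold>\<leadsto> A#}"
    | A B where "MP \<in> X" "\<Gamma>\<^sub>0 = {#(A \<^bold>\<leadsto> B) \<^bold>\<longrightarrow> (A \<^bold>\<longrightarrow> B)#}"
    | A B where "CEM \<in> X" "\<Gamma>\<^sub>0 = {#(A \<^bold>\<leadsto> B) \<^bold>\<or> (A \<^bold>\<leadsto> \<^bold>\<not> B)#}"
    unfolding hilbert_rules_def CK_def by (blast elim: axiom_rules_cases)
  then show ?case
  proof cases
    case 1
    then have "gentzen (gentzen_rules X) {#A \<^bold>\<longleftrightarrow> A'#}"
      using rule.IH by (simp only: list.set ball_simps Disj_single)
    then have "gentzen (gentzen_rules X) {#\<^bold>\<not> A, A'#}" "gentzen (gentzen_rules X) {#\<^bold>\<not> A', A#}"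
      by (simp_all only: gentzen_and_iff gentzen_imp_iff)
    then show ?thesis
      unfolding 1 Disj_single gentzen_and_iff gentzen_imp_iff by (intro conjI gentzen_congruence)
  next
    case 2
    then show ?thesis using rule.IH gentzen_normality[of X Bs B A] by simp
  next
    case 3
    then show ?thesis using gentzen_ID by simp
  next
    case 4
    have "gentzen (gentzen_rules X) {#A \<^bold>\<longrightarrow> B, \<^bold>\<not> (A \<^bold>\<leadsto> B)#}"
      unfolding gentzen_imp_iff by (rule gentzen_structural[OF gentzen_MP[OF 4(1)]]) auto
    then have "gentzen (gentzen_rules X) {#\<^bold>\<not> (A \<^bold>\<leadsto> B), A \<^bold>\<longrightarrow> B#}"
      by (rule gentzen_structural) auto
    then show ?thesis
      unfolding 4(2) Disj_single by (rule gentzen_imp_iff[THEN iffD2])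
  next
    case 5
    then show ?thesis
      unfolding 5(2) Disj_single gentzen_or_iff by (intro gentzen_CEM)
  qed
qed

section \<open>Admissibility of cut and the final statement\<close>

lemma admissible_cut: "admissible cut_rules (gentzen_rules X)"
  unfolding admissible_def
proof (intro allI iffI)
  fix \<Gamma> :: "'v sequent"
  show "gentzen (gentzen_rules X) \<Gamma>" if "gentzen (gentzen_rules X \<union> cut_rules) \<Gamma>"
    using that
  proof (induction rule: gentzen.induct)
    case (rule \<Gamma>s \<Gamma>\<^sub>0)
    then consider "(\<Gamma>s, \<Gamma>\<^sub>0) \<in> gentzen_rules X"
      | \<Gamma> \<Delta> A where "\<Gamma>s = [\<Gamma> + {#A#}, \<Delta> + {#\<^bold>\<not> A#}]" "\<Gamma>\<^sub>0 = \<Gamma> + \<Delta>"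
      by (auto simp: cut_rules_def)
    then show ?case
    proof cases
      case 1
      then show ?thesis using rule.IH gentzen.rule[of _ _ "gentzen_rules X"] by blast
    next
      case 2
      then show ?thesis using rule.IH gentzen_cut[of X A \<Gamma> \<Delta>] by simp
    qed
  qed (blast intro: gentzen.ax gentzen.neg_bot gentzen.neg_and gentzen.and_intro gentzen.neg_neg)+
  show "gentzen (gentzen_rules X \<union> cut_rules) \<Gamma>" if "gentzen (gentzen_rules X) \<Gamma>"
    using that
  proof (induction rule: gentzen.induct)
    case (rule \<Gamma>s \<Gamma>\<^sub>0)
    then show ?case using gentzen.rule[of \<Gamma>s \<Gamma>\<^sub>0 "gentzen_rules X \<union> cut_rules"] by blast
  qed (blast intro: gentzen.ax gentzen.neg_bot gentzen.neg_and gentzen.and_intro gentzen.neg_neg)+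
qed

theorem theorem6p13:
  fixes X :: "cond_axiom set"
  shows "(\<forall>A :: 'v fm. hilbert (hilbert_rules X) A \<longrightarrow> gentzen (gentzen_rules X) {#A#})
       \<and> admissible (cut_rules :: 'v seqrule set) (gentzen_rules X)"
  using gentzen_of_hilbert admissible_cut by blast

end
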